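(* Suppose $\widetilde G$ is an abstract band graph with $d$ tiles that corresponds to a one-sided closed curve, with cut edge labelled $a$ and diagonal labels $i_1,\dots,i_d$, and with signs $b_T(\mathcal L_T,i_j)\in\{1,-1\}$ for $1\le j\le d$. Let $M_d$ be the associated $2\times 2$ matrix. Then its good matching enumerator is given as follows, where the sums are over all good matchings $P$ of $\widetilde G$. If $b_T(\mathcal L_T,i_d)=1$, then $$\sum_P x(P)\,y_{\mathcal L_T}(P)=x_{i_1}\cdots x_{i_d}\,\operatorname{tr}\left(\begin{bmatrix}\frac{x_a}{x_{i_d}} & x_{i_1}y_{i_d}\\ \frac1{x_{i_1}} & 0\end{bmatrix}M_d\right).$$ If $b_T(\mathcal L_T,i_d)=-1$, then $$\sum_P x(P)\,y_{\mathcal L_T}(P)=x_{i_1}\cdots x_{i_d}\,\operatorname{tr}\left(\begin{bmatrix}\frac{x_a y_{i_d}}{x_{i_d}} & x_{i_1}\\ \frac{y_{i_d}}{x_{i_1}} & 0\end{bmatrix}M_d\right).$$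
   Context: **Underlying snake graph.** Unit square tiles $G_1,\dots,G_d$ in the plane; for $1\le j\le d-1$ the tile $G_{j+1}$ is glued either directly above $G_j$ (then the parallelogram $H_j$, formed by the upper-right half of $G_j$ and the lower-left half of $G_{j+1}$, is called north-pointing) or directly to the right of $G_j$ ($H_j$ is called east-pointing). The diagonal of $G_j$ from its NW to its SE corner carries the label $i_j$; diagonals are not edges of the graph. Edge labels: if $H_j$ is north-pointing, the common edge of $G_j,G_{j+1}$ is labelled $a_j$, the East edge of $G_j$ is labelled $i_{j+1}$ and the West edge of $G_{j+1}$ is labelled $i_j$. If $H_j$ is east-pointing, the common edge is labelled $a_j$, the North edge of $G_j$ is labelled $i_{j+1}$ and the South edge of $G_{j+1}$ is labelled $i_j$. **End labels (one-sided case).** The South edge of $G_1$ is labelled $a$ and the West edge of $G_1$ is labelled $i_d$. If $d$ is odd, the North edge of $G_d$ is labelled $a'$ and the East edge of $G_d$ is labelled $i_1$; if $d$ is even, the East edge of $G_d$ is labelled $a'$ and the North edge of $G_d$ is labelled $i_1$. The band graph $\widetilde G$ is obtained by identifying the edge $a$ with the edge $a'$, so that the SW corner of $G_1$ is identified with the endpoint of $a'$ other than the NE corner of $G_d$, and the SE corner of $G_1$ with the NE corner of $G_d$; $x_{a'}=x_a$. The identified edge is called the cut edge $b$, with endpoints $x,y$. **Good matchings.** A good matching $\overline P$ of $\widetilde G$ is a perfect matching $P$ of the un-identified underlying snake graph such that one of the following holds: (i) $x$ and $y$ are matched to each other, i.e. $b\in\overline P$; (ii) $b\notin\overline P$ and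 $x$ and $y$ are matched with the two edges perpendicular to $b$ on tile $G_1$; (iii) $b\notin\overline P$ and $x$ and $y$ are matched with the two edges perpendicular to $b$ on tile $G_d$. Here $\overline P$ is the set of edges of $\widetilde G$ to which $P$ descends after removing one of $a,a'$ from $P$. **Weights.** $x_e$ ($e$ a label) and $y_{i_j}$ are commuting indeterminates; for a good matching, $x(P)$ is the product of $x_e$ over the labels $e$ of the edges of $\overline P$. The signs $b_T(\mathcal L_T,i_j)$ are the Shear coordinates, with respect to a triangulation $T$, of the principal lamination $\mathcal L_T$ at the arcs labelling the diagonals. A perfect matching $P$ of the snake graph orients every diagonal: there is a unique path from the SW corner of $G_1$ to the NE corner of $G_d$ that alternates between edges of $P$ and the diagonals; the diagonal of $G_j$ is oriented up if traversed from SE to NW and down if traversed from NW to SE. The diagonal of $G_j$ is $\mathcal L_T$-oriented if: $j$ is odd and either $b_T(\mathcal L_T,i_j)=1$ and it is oriented down, or $b_T(\mathcal L_T,i_j)=-1$ and it is oriented up; or $j$ is even and either $b_T(\mathcal L_T,i_j)=1$ and it is oriented up, or $b_T(\mathcal L_T,i_j)=-1$ and it is oriented down. Put $y_{\mathcal L_T}(P)=\prod y_{i_j}$ over all $j$ whose diagonal is $\mathcal L_T$-oriented. **Matrices.** $M_1=I_2$ and $M_d=m_{d-1}\cdots m_1$ for $d>1$. The matrix $m_1$ is of first type if $H_1$ is north-pointing, and otherwise of second type; for $j>1$, $m_j$ is of first type if $H_{j-1}$ and $H_j$ have the same shape, and otherwise of second type. If $b_T(\mathcal L_T,i_j)=1$,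 then $$m_j=\begin{bmatrix}1&0\\ \frac{x_{a_j}}{x_{i_j}x_{i_{j+1}}}&y_{i_j}\end{bmatrix}\ (\text{first type}),\qquad m_j=\begin{bmatrix}\frac{x_{i_{j+1}}}{x_{i_j}}&x_{a_j}y_{i_j}\\0&\frac{x_{i_j}y_{i_j}}{x_{i_{j+1}}}\end{bmatrix}\ (\text{second type}).$$ If $b_T(\mathcal L_T,i_j)=-1$, then $$m_j=\begin{bmatrix}y_{i_j}&0\\ \frac{x_{a_j}y_{i_j}}{x_{i_j}x_{i_{j+1}}}&1\end{bmatrix}\ (\text{first type}),\qquad m_j=\begin{bmatrix}\frac{x_{i_{j+1}}y_{i_j}}{x_{i_j}}&x_{a_j}\\0&\frac{x_{i_j}}{x_{i_{j+1}}}\end{bmatrix}\ (\text{second type}).$$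
   Formalization: For j>1, m_j keeps the type of m_{j-1} if H_{j-1}, H_j differ in shape and switches if they agree; in (ii),(iii) x and y need only be matched by edges on the same side of b, not by the two edges perpendicular to b. The literal conventions make the formula false. *)

theory Defs
  imports "HOL-Analysis.Determinants"
begin

text \<open>
  An abstract band graph is given by its number \<open>d\<close> of tiles, the shapes \<open>H j\<close> of the parallelograms
  (\<open>1 \<le> j < d\<close>), the labels \<open>i j\<close> of the diagonals, the labels \<open>a j\<close> of the edges common to the tiles
  \<open>j\<close> and \<open>j + 1\<close>, and the label \<open>c\<close> of the cut edge. Tiles are numbered from 1; values of these
  functions outside the stated ranges are never used.
\<close>

datatype shape = North_Pointing | East_Pointing

datatype side = South | West | North | East

type_synonym vertex = "nat \<times> nat"
type_synonym edge = "vertex set"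

subsection \<open>The underlying snake graph\<close>

fun sw :: "(nat \<Rightarrow> shape) \<Rightarrow> nat \<Rightarrow> vertex" where
  "sw H 0 = (0, 0)"
| "sw H (Suc 0) = (0, 0)"
| "sw H (Suc (Suc j)) =
     (case H (Suc j) of
        North_Pointing \<Rightarrow> (fst (sw H (Suc j)), snd (sw H (Suc j)) + 1)
      | East_Pointing \<Rightarrow> (fst (sw H (Suc j)) + 1, snd (sw H (Suc j))))"

definition se :: "(nat \<Rightarrow> shape) \<Rightarrow> nat \<Rightarrow> vertex" where
  "se H j = (fst (sw H j) + 1, snd (sw H j))"

definition nw :: "(nat \<Rightarrow> shape) \<Rightarrow> nat \<Rightarrow> vertex" where
  "nw H j = (fst (sw H j), snd (sw H j) + 1)"

definition ne :: "(nat \<Rightarrow> shape) \<Rightarrow> nat \<Rightarrow> vertex" where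
  "ne H j = (fst (sw H j) + 1, snd (sw H j) + 1)"

fun tile_edge :: "(nat \<Rightarrow> shape) \<Rightarrow> nat \<Rightarrow> side \<Rightarrow> edge" where
  "tile_edge H j South = {sw H j, se H j}"
| "tile_edge H j West = {sw H j, nw H j}"
| "tile_edge H j North = {nw H j, ne H j}"
| "tile_edge H j East = {se H j, ne H j}"

definition snake_vertices :: "nat \<Rightarrow> (nat \<Rightarrow> shape) \<Rightarrow> vertex set" where
  "snake_vertices d H = (\<Union>j\<in>{1..d}. {sw H j, se H j, nw H j, ne H j})"

definition snake_edges :: "nat \<Rightarrow> (nat \<Rightarrow> shape) \<Rightarrow> edge set" where
  "snake_edges d H = {tile_edge H j s | j s. j \<in> {1..d}}"

definition perfect_matching :: "nat \<Rightarrow> (nat \<Rightarrow> shape) \<Rightarrow> edge set \<Rightarrow> bool" where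
  "perfect_matching d H P \<longleftrightarrow>
     P \<subseteq> snake_edges d H \<and> (\<forall>v\<in>snake_vertices d H. \<exists>!e. e \<in> P \<and> v \<in> e)"

subsection \<open>Edge labels, with the end labels of a one-sided curve\<close>

text \<open>
  The two copies \<open>a\<close>, \<open>a'\<close> of the cut edge both get the label \<open>c\<close>; this is the convention that they
  have the same weight.
\<close>

fun side_label ::
  "nat \<Rightarrow> (nat \<Rightarrow> shape) \<Rightarrow> (nat \<Rightarrow> 'l) \<Rightarrow> (nat \<Rightarrow> 'l) \<Rightarrow> 'l \<Rightarrow> nat \<Rightarrow> side \<Rightarrow> 'l"
where
  "side_label d H i a c j South =
     (if j = 1 then c
      else if H (j - 1) = North_Pointing then a (j - 1) else i (j - 1))"
| "side_label d H i a c j West =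
     (if j = 1 then i d
      else if H (j - 1) = North_Pointing then i (j - 1) else a (j - 1))"
| "side_label d H i a c j North =
     (if j = d then (if odd d then c else i 1)
      else if H j = North_Pointing then a j else i (j + 1))"
| "side_label d H i a c j East =
     (if j = d then (if odd d then i 1 else c)
      else if H j = North_Pointing then i (j + 1) else a j)"

text \<open>
  An edge common to two tiles receives the same label from both of them, so the description is
  unique for every edge of the snake graph.
\<close>

definition edge_label ::
  "nat \<Rightarrow> (nat \<Rightarrow> shape) \<Rightarrow> (nat \<Rightarrow> 'l) \<Rightarrow> (nat \<Rightarrow> 'l) \<Rightarrow> 'l \<Rightarrow> edge \<Rightarrow> 'l"
where
  "edge_label d H i a c e =
     (THE l. \<exists>j\<in>{1..d}. \<exists>s. e = tile_edge H j s \<and> l = side_label d H i a c j s)"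

subsection \<open>The band graph and its good matchings\<close>

definition first_cut :: "(nat \<Rightarrow> shape) \<Rightarrow> edge" where
  "first_cut H = tile_edge H 1 South"

definition last_cut :: "nat \<Rightarrow> (nat \<Rightarrow> shape) \<Rightarrow> edge" where
  "last_cut d H = tile_edge H d (if odd d then North else East)"

text \<open>
  The quotient maps onto the band graph. Since the band graph can have loops and parallel edges, its
  edges are not represented by pairs of band vertices, but by the edges of the snake graph, where the
  cut edge \<open>b\<close> is represented by \<open>first_cut\<close>. The vertices \<open>x\<close> and \<open>y\<close> are represented by the
  south-west and south-east corners of the first tile.
\<close>

definition band_vertex :: "nat \<Rightarrow> (nat \<Rightarrow> shape) \<Rightarrow> vertex \<Rightarrow> vertex" where
  "band_vertex d H v =
     (if v = ne H d then se H 1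
      else if v \<in> last_cut d H then sw H 1
      else v)"

definition band_edge :: "nat \<Rightarrow> (nat \<Rightarrow> shape) \<Rightarrow> edge \<Rightarrow> edge" where
  "band_edge d H e = (if e = last_cut d H then first_cut H else e)"

definition descended :: "nat \<Rightarrow> (nat \<Rightarrow> shape) \<Rightarrow> edge set \<Rightarrow> edge set" where
  "descended d H P =
     band_edge d H ` (P - {if last_cut d H \<in> P then last_cut d H else first_cut H})"

text \<open>
  \<open>matched_beside d H Q C\<close>: both \<open>x\<close> and \<open>y\<close> are matched by edges of \<open>Q\<close> lying on that side of the cut
  edge on which \<open>C\<close> (one of its two copies) lies, i.e. by edges ending in \<open>C\<close> before the
  identification. For \<open>C = first_cut H\<close>, \<open>d > 1\<close> and \<open>H 1\<close> north-pointing these can only be the two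
  edges of the first tile perpendicular to \<open>b\<close>. If \<open>H 1\<close> is east-pointing, \<open>y\<close> may also be matched by
  the south edge of the second tile; such matchings contribute to the enumerator, so they must not
  be excluded. The situation at the last tile is analogous.
\<close>

definition matched_beside ::
  "nat \<Rightarrow> (nat \<Rightarrow> shape) \<Rightarrow> edge set \<Rightarrow> edge \<Rightarrow> bool"
where
  "matched_beside d H Q C \<longleftrightarrow>
     (\<forall>v\<in>{sw H 1, se H 1}. \<exists>e\<in>Q. \<exists>u\<in>e \<inter> C. band_vertex d H u = v)"

definition good_matching :: "nat \<Rightarrow> (nat \<Rightarrow> shape) \<Rightarrow> edge set \<Rightarrow> bool" where
  "good_matching d H P \<longleftrightarrow>
     perfect_matching d H P \<and>
     (first_cut H \<in> P \<or> last_cut d H \<in> P) \<and>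
     (let Q = descended d H P; b = first_cut H in
        b \<in> Q \<or>
        (b \<notin> Q \<and> matched_beside d H Q (first_cut H)) \<or>
        (b \<notin> Q \<and> matched_beside d H Q (last_cut d H)))"

subsection \<open>Weights\<close>

definition x_weight ::
  "nat \<Rightarrow> (nat \<Rightarrow> shape) \<Rightarrow> (nat \<Rightarrow> 'l) \<Rightarrow> (nat \<Rightarrow> 'l) \<Rightarrow> 'l \<Rightarrow> ('l \<Rightarrow> 'k::field)
     \<Rightarrow> edge set \<Rightarrow> 'k"
where
  "x_weight d H i a c x P = (\<Prod>e\<in>descended d H P. x (edge_label d H i a c e))"

text \<open>
  No diagonal ends in the south-west corner of the first tile, so an alternating path starting there
  starts with an edge of the matching.
\<close>

definition alternating_path ::
  "nat \<Rightarrow> (nat \<Rightarrow> shape) \<Rightarrow> edge set \<Rightarrow> vertex list \<Rightarrow> bool"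
where
  "alternating_path d H P vs \<longleftrightarrow>
     vs \<noteq> [] \<and> distinct vs \<and> hd vs = sw H 1 \<and> last vs = ne H d \<and>
     (\<forall>k. Suc k < length vs \<longrightarrow>
        (if even k then {vs ! k, vs ! Suc k} \<in> P
         else \<exists>j\<in>{1..d}. {vs ! k, vs ! Suc k} = {nw H j, se H j}))"

definition oriented_up :: "nat \<Rightarrow> (nat \<Rightarrow> shape) \<Rightarrow> edge set \<Rightarrow> nat \<Rightarrow> bool" where
  "oriented_up d H P j \<longleftrightarrow>
     (\<exists>vs k. alternating_path d H P vs \<and> Suc k < length vs \<and>
        vs ! k = se H j \<and> vs ! Suc k = nw H j)"

definition oriented_down :: "nat \<Rightarrow> (nat \<Rightarrow> shape) \<Rightarrow> edge set \<Rightarrow> nat \<Rightarrow> bool" where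
  "oriented_down d H P j \<longleftrightarrow>
     (\<exists>vs k. alternating_path d H P vs \<and> Suc k < length vs \<and>
        vs ! k = nw H j \<and> vs ! Suc k = se H j)"

text \<open>\<open>bT l\<close> is the shear coordinate of the principal lamination at the arc \<open>l\<close>.\<close>

definition L_oriented ::
  "nat \<Rightarrow> (nat \<Rightarrow> shape) \<Rightarrow> (nat \<Rightarrow> 'l) \<Rightarrow> ('l \<Rightarrow> int) \<Rightarrow> edge set \<Rightarrow> nat \<Rightarrow> bool"
where
  "L_oriented d H i bT P j \<longleftrightarrow>
     (odd j \<and> (bT (i j) = 1 \<and> oriented_down d H P j \<or> bT (i j) = -1 \<and> oriented_up d H P j)) \<or>
     (even j \<and> (bT (i j) = 1 \<and> oriented_up d H P j \<or> bT (i j) = -1 \<and> oriented_down d H P j))"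

definition y_weight ::
  "nat \<Rightarrow> (nat \<Rightarrow> shape) \<Rightarrow> (nat \<Rightarrow> 'l) \<Rightarrow> ('l \<Rightarrow> int) \<Rightarrow> ('l \<Rightarrow> 'k::field)
     \<Rightarrow> edge set \<Rightarrow> 'k"
where
  "y_weight d H i bT y P = (\<Prod>j\<in>{j\<in>{1..d}. L_oriented d H i bT P j}. y (i j))"

subsection \<open>Matrices\<close>

definition mat22 :: "'k::zero \<Rightarrow> 'k \<Rightarrow> 'k \<Rightarrow> 'k \<Rightarrow> 'k^2^2" where
  "mat22 p q r s = vector [vector [p, q], vector [r, s]]"

text \<open>
  The type is kept when the shape changes and switches when the shape is repeated: matrices of
  constant type belong to arcs forming a fan, and the snake graph of a fan is a zigzag. (The rule
  ``for \<open>j > 1\<close>, first type iff \<open>H (j - 1)\<close> and \<open>H j\<close> have the same shape'' would not give the matching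
  enumerator: already for \<open>d = 3\<close>, both shapes north-pointing and all variables 1, there are 4 good
  matchings, while that rule gives the trace 3.)
\<close>

fun first_type :: "(nat \<Rightarrow> shape) \<Rightarrow> nat \<Rightarrow> bool" where
  "first_type H 0 \<longleftrightarrow> False"
| "first_type H (Suc 0) \<longleftrightarrow> H 1 = North_Pointing"
| "first_type H (Suc (Suc j)) \<longleftrightarrow>
     (if H (Suc j) = H (Suc (Suc j)) then \<not> first_type H (Suc j) else first_type H (Suc j))"

definition step_matrix ::
  "(nat \<Rightarrow> shape) \<Rightarrow> (nat \<Rightarrow> 'l) \<Rightarrow> (nat \<Rightarrow> 'l) \<Rightarrow> ('l \<Rightarrow> int) \<Rightarrow> ('l \<Rightarrow> 'k::field)
     \<Rightarrow> ('l \<Rightarrow> 'k) \<Rightarrow> nat \<Rightarrow> 'k^2^2"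
where
  "step_matrix H i a bT x y j =
     (if bT (i j) = 1 then
        (if first_type H j
         then mat22 1 0
                    (x (a j) / (x (i j) * x (i (j + 1)))) (y (i j))
         else mat22 (x (i (j + 1)) / x (i j)) (x (a j) * y (i j))
                    0 (x (i j) * y (i j) / x (i (j + 1))))
      else
        (if first_type H j
         then mat22 (y (i j)) 0
                    (x (a j) * y (i j) / (x (i j) * x (i (j + 1)))) 1
         else mat22 (x (i (j + 1)) * y (i j) / x (i j)) (x (a j))
                    0 (x (i j) / x (i (j + 1)))))"

fun band_matrix ::
  "(nat \<Rightarrow> shape) \<Rightarrow> (nat \<Rightarrow> 'l) \<Rightarrow> (nat \<Rightarrow> 'l) \<Rightarrow> ('l \<Rightarrow> int) \<Rightarrow> ('l \<Rightarrow> 'k::field)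
     \<Rightarrow> ('l \<Rightarrow> 'k) \<Rightarrow> nat \<Rightarrow> 'k^2^2"
where
  "band_matrix H i a bT x y 0 = mat 1"
| "band_matrix H i a bT x y (Suc 0) = mat 1"
| "band_matrix H i a bT x y (Suc (Suc n)) =
     step_matrix H i a bT x y (Suc n) ** band_matrix H i a bT x y (Suc n)"

end

theory Submission
  imports Defs
begin

text \<open>
  All edges of the snake graph join consecutive levels of \<open>(p, q) \<mapsto> p + q\<close>. Level \<open>0\<close> is the
  south-west corner of the first tile, level \<open>j\<close> consists of the two ends of the diagonal of tile
  \<open>j\<close>, and level \<open>d + 1\<close> is the north-east corner of the last tile. Hence a perfect matching has
  exactly one edge between any two consecutive levels, and it amounts to a choice of orientation of
  each diagonal, subject to one forbidden pair of orientations for consecutive diagonals. With the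
  orientations of the even diagonals reversed, the matching enumerator is a sum over paths of
  a two-state chain, and up to a diagonal change of basis the transfer matrices of this chain are
  the given matrices. A matching is good iff the first or the last state of the chain is the first
  one, which explains the entry \<open>0\<close> of the closing matrix.
\<close>

subsection \<open>Levels\<close>

definition level :: "vertex \<Rightarrow> nat" where
  "level v = fst v + snd v"

lemma sw_Suc:
  assumes "1 \<le> j"
  shows "sw H (Suc j) = (if H j = North_Pointing then nw H j else se H j)"
  using assms by (cases j) (auto simp: nw_def se_def split: shape.splits)

lemma level_sw: "level (sw H (Suc j)) = j"
proof (induction j)
  case (Suc j)
  then show ?case by (subst sw_Suc) (auto simp: level_def nw_def se_def)
qed (simp add: level_def)

lemma level_origin [simp]: "level (0, 0) = 0"
  by (simp add: level_def)

lemma level_corners: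
  assumes "1 \<le> j"
  shows "level (se H j) = j" "level (nw H j) = j" "level (ne H j) = Suc j"
  using level_sw[of H "j - 1"] assms by (auto simp: level_def nw_def se_def ne_def)

lemma nw_neq_se [simp]: "nw H j \<noteq> se H j" "se H j \<noteq> nw H j"
  by (auto simp: nw_def se_def)

lemma north_glue:
  assumes "1 \<le> j" "H j = North_Pointing"
  shows "sw H (Suc j) = nw H j" "se H (Suc j) = ne H j"
  using sw_Suc[OF assms(1), of H] assms(2) by (auto simp: nw_def se_def ne_def)

lemma east_glue:
  assumes "1 \<le> j" "H j = East_Pointing"
  shows "sw H (Suc j) = se H j" "nw H (Suc j) = ne H j"
  using sw_Suc[OF assms(1), of H] assms(2) by (auto simp: nw_def se_def ne_def)

definition layer :: "nat \<Rightarrow> (nat \<Rightarrow> shape) \<Rightarrow> nat \<Rightarrow> vertex set" where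
  "layer d H k =
     (if k = 0 then {sw H 1} else if k = Suc d then {ne H d} else {nw H k, se H k})"

lemma level_layer: "1 \<le> d \<Longrightarrow> k \<le> Suc d \<Longrightarrow> v \<in> layer d H k \<Longrightarrow> level v = k"
  by (auto simp: layer_def level_corners split: if_splits)

lemma sw_in_layer: "1 \<le> j \<Longrightarrow> j \<le> d \<Longrightarrow> sw H j \<in> layer d H (j - 1)"
  using sw_Suc[of "j - 1" H] by (cases "j = 1") (auto simp: layer_def)

lemma ne_in_layer: "1 \<le> j \<Longrightarrow> j \<le> d \<Longrightarrow> ne H j \<in> layer d H (Suc j)"
  using north_glue[of j H] east_glue[of j H] by (cases "H j") (auto simp: layer_def)

lemma snake_vertices_layers:
  assumes "1 \<le> d"
  shows "snake_vertices d H = (\<Union>k\<le>Suc d. layer d H k)"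
proof
  show "snake_vertices d H \<subseteq> (\<Union>k\<le>Suc d. layer d H k)"
  proof
    fix v assume "v \<in> snake_vertices d H"
    then obtain j where j: "1 \<le> j" "j \<le> d" "v \<in> {sw H j, se H j, nw H j, ne H j}"
      unfolding snake_vertices_def by auto
    then have "v \<in> layer d H (j - 1) \<or> v \<in> layer d H j \<or> v \<in> layer d H (Suc j)"
      using sw_in_layer[of j d H] ne_in_layer[of j d H] by (auto simp: layer_def)
    then show "v \<in> (\<Union>k\<le>Suc d. layer d H k)"
      using j by (auto intro: le_trans[OF diff_le_self])
  qed
  show "(\<Union>k\<le>Suc d. layer d H k) \<subseteq> snake_vertices d H"
  proof
    fix v assume "v \<in> (\<Union>k\<le>Suc d. layer d H k)"
    then obtain k where k: "k \<le> Suc d" "v \<in> layer d H k" by auto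
    define j where "j = (if k = 0 then 1 else if k = Suc d then d else k)"
    have "j \<in> {1..d}" "v \<in> {sw H j, se H j, nw H j, ne H j}"
      using k assms by (auto simp: layer_def j_def split: if_splits)
    then show "v \<in> snake_vertices d H" unfolding snake_vertices_def by blast
  qed
qed

subsection \<open>Matchings from orientations\<close>

text \<open>
  \<open>s j\<close> says that the diagonal of tile \<open>j\<close> is oriented up; then the alternating path enters level
  \<open>j\<close> at \<open>enter d H s j\<close> and leaves it at \<open>leave H s j\<close>.
\<close>

definition enter :: "nat \<Rightarrow> (nat \<Rightarrow> shape) \<Rightarrow> (nat \<Rightarrow> bool) \<Rightarrow> nat \<Rightarrow> vertex" where
  "enter d H s j = (if j = Suc d then ne H d else if s j then se H j else nw H j)"

definition leave :: "(nat \<Rightarrow> shape) \<Rightarrow> (nat \<Rightarrow> bool) \<Rightarrow> nat \<Rightarrow> vertex" where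
  "leave H s j = (if j = 0 then sw H 1 else if s j then nw H j else se H j)"

definition step_edge :: "nat \<Rightarrow> (nat \<Rightarrow> shape) \<Rightarrow> (nat \<Rightarrow> bool) \<Rightarrow> nat \<Rightarrow> edge" where
  "step_edge d H s k = {leave H s k, enter d H s (Suc k)}"

definition matching_of :: "nat \<Rightarrow> (nat \<Rightarrow> shape) \<Rightarrow> (nat \<Rightarrow> bool) \<Rightarrow> edge set" where
  "matching_of d H s = step_edge d H s ` {..d}"

text \<open>For a north-pointing \<open>H j\<close>, two down orientations would ask for an edge
  from \<open>se H j\<close> to \<open>nw H (Suc j)\<close>; for an east-pointing one, two up
  orientations would ask for an edge from \<open>nw H j\<close> to \<open>se H (Suc j)\<close>.
  Neither pair is adjacent.\<close>

definition admissible :: "nat \<Rightarrow> (nat \<Rightarrow> shape) \<Rightarrow> (nat \<Rightarrow> bool) \<Rightarrow> bool" where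
  "admissible d H s \<longleftrightarrow>
     (\<forall>j\<in>{1..<d}. if H j = North_Pointing then s j \<or> s (Suc j) else \<not> s j \<or> \<not> s (Suc j))"

text \<open>An upward diagonal is entered at its SE corner, so that corner is matched towards the
  previous level. This reads the orientation off the matching without paths.\<close>

definition up_of :: "(nat \<Rightarrow> shape) \<Rightarrow> edge set \<Rightarrow> nat \<Rightarrow> bool" where
  "up_of H P j \<longleftrightarrow> (\<exists>u. Suc (level u) = j \<and> {u, se H j} \<in> P)"

lemma level_enter: "1 \<le> d \<Longrightarrow> 1 \<le> k \<Longrightarrow> k \<le> Suc d \<Longrightarrow> level (enter d H s k) = k"
  by (auto simp: enter_def level_corners)

lemma level_leave: "level (leave H s k) = k"
  by (auto simp: leave_def level_corners)

lemma enter_neq_leave: "1 \<le> k \<Longrightarrow> k \<le> d \<Longrightarrow> enter d H s k \<noteq> leave H s k"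
  by (auto simp: enter_def leave_def)

lemma layer_inner: "1 \<le> k \<Longrightarrow> k \<le> d \<Longrightarrow> layer d H k = {enter d H s k, leave H s k}"
  by (auto simp: layer_def enter_def leave_def)

lemma in_step_edge_level:
  assumes "1 \<le> d" "k \<le> d" "v \<in> step_edge d H s k"
  shows "level v = k \<and> v = leave H s k \<or> level v = Suc k \<and> v = enter d H s (Suc k)"
  using assms by (auto simp: step_edge_def level_enter level_leave)

text \<open>The ends of a step edge lie on different levels, so the unordered pair still tells which
  end is left and which is entered.\<close>

lemma step_edge_eqD:
  assumes "1 \<le> d" "k \<le> d" "l \<le> d" "step_edge d H s k = step_edge d H s' l"
  shows "k = l" "leave H s k = leave H s' k" "enter d H s (Suc k) = enter d H s' (Suc k)"
proof -
  have "leave H s k \<in> step_edge d H s' l" "leave H s' l \<in> step_edge d H s k"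
    "enter d H s (Suc k) \<in> step_edge d H s' l"
    using assms(4) by (auto simp: step_edge_def)
  from this(1,2) show kl: "k = l"
    using in_step_edge_level[OF assms(1,3), of "leave H s k" H s']
      in_step_edge_level[OF assms(1,2), of "leave H s' l" H s] by (auto simp: level_leave)
  show "leave H s k = leave H s' k"
    using in_step_edge_level[OF assms(1,3), of "leave H s k" H s'] assms(4) kl
    by (auto simp: step_edge_def level_leave)
  show "enter d H s (Suc k) = enter d H s' (Suc k)"
    using in_step_edge_level[OF assms(1,3), of "enter d H s (Suc k)" H s'] assms kl
    by (auto simp: step_edge_def level_enter)
qed

lemma inj_step_edge: "1 \<le> d \<Longrightarrow> inj_on (step_edge d H s) {..d}"
  by (rule inj_onI) (use step_edge_eqD(1) in blast)

section \<open>Step edges as sides of tiles\<close>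

lemma step_edge_first:
  "1 \<le> d \<Longrightarrow> step_edge d H s 0 = tile_edge H 1 (if s 1 then South else West)"
  by (auto simp: step_edge_def leave_def enter_def)

lemma step_edge_last:
  "1 \<le> d \<Longrightarrow> step_edge d H s d = tile_edge H d (if s d then North else East)"
  by (auto simp: step_edge_def leave_def enter_def)

lemma step_edge_north:
  assumes "1 \<le> k" "k < d" "H k = North_Pointing" "s k \<or> s (Suc k)"
  shows "step_edge d H s k =
    (if s k then if s (Suc k) then tile_edge H k North else tile_edge H (Suc k) West
     else tile_edge H k East)"
  using assms by (auto simp: step_edge_def leave_def enter_def north_glue)

lemma step_edge_east:
  assumes "1 \<le> k" "k < d" "H k = East_Pointing" "\<not> s k \<or> \<not> s (Suc k)"
  shows "step_edge d H s k =
    (if s k then tile_edge H k North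
     else if s (Suc k) then tile_edge H (Suc k) South else tile_edge H k East)"
  using assms by (auto simp: step_edge_def leave_def enter_def east_glue)

lemma tile_edge_in_snake: "1 \<le> j \<Longrightarrow> j \<le> d \<Longrightarrow> tile_edge H j t \<in> snake_edges d H"
  unfolding snake_edges_def by force

lemma step_edge_in_snake:
  assumes "1 \<le> d" "admissible d H s" "k \<le> d"
  shows "step_edge d H s k \<in> snake_edges d H"
proof (cases "k = 0 \<or> k = d")
  case True
  then show ?thesis
    using assms(1) step_edge_first[of d H s] step_edge_last[of d H s]
    by (auto simp: tile_edge_in_snake simp del: tile_edge.simps)
next
  case False
  then have k: "1 \<le> k" "k < d" using assms by auto
  then have adm: "if H k = North_Pointing then s k \<or> s (Suc k) else \<not> s k \<or> \<not> s (Suc k)"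
    using bspec[OF assms(2)[unfolded admissible_def], of k] by simp
  have "step_edge d H s k \<in> {tile_edge H k North, tile_edge H k East,
      tile_edge H (Suc k) South, tile_edge H (Suc k) West}"
  proof (cases "H k")
    case North_Pointing
    then show ?thesis using step_edge_north[of k d H s] k adm by auto
  next
    case East_Pointing
    then show ?thesis using step_edge_east[of k d H s] k adm by auto
  qed
  then show ?thesis
    using k by (auto simp: tile_edge_in_snake simp del: tile_edge.simps)
qed

text \<open>An inner layer has two distinct vertices: the one left is covered by step edge
  \<open>k\<close>, the one entered by step edge \<open>k - 1\<close>. Levels exclude all other step
  edges.\<close>

lemma matching_of_covered:
  assumes "1 \<le> d" "k \<le> Suc d" "v \<in> layer d H k"
  obtains l where "l \<le> d" "v \<in> step_edge d H s l"
    "\<And>m. m \<le> d \<Longrightarrow> v \<in> step_edge d H s m \<Longrightarrow> m = l"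
proof -
  have lv: "level v = k" using level_layer assms by blast
  have "v = leave H s k \<and> k \<le> d \<or> v = enter d H s k \<and> 1 \<le> k"
    using assms(2,3) by (auto simp: layer_def enter_def leave_def split: if_splits)
  then consider "v = leave H s k" "k \<le> d" | "v = enter d H s k" "1 \<le> k"
    by blast
  then show thesis
  proof cases
    case 1
    have "m = k" if "m \<le> d" "v \<in> step_edge d H s m" for m
    proof (rule ccontr)
      assume "m \<noteq> k"
      then have "Suc m = k" "v = enter d H s (Suc m)"
        using in_step_edge_level[OF assms(1) that] lv by auto
      then show False using 1 enter_neq_leave[of k d H s] by auto
    qed
    with 1 show thesis by (intro that[of k]) (auto simp: step_edge_def)
  next
    case 2
    have "m = k - 1" if "m \<le> d" "v \<in> step_edge d H s m" for m
    proof (rule ccontr)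
      assume "m \<noteq> k - 1"
      then have "m = k" "v = leave H s k"
        using in_step_edge_level[OF assms(1) that] lv by auto
      then show False using 2 enter_neq_leave[of k d H s] \<open>m \<le> d\<close> by auto
    qed
    with 2 assms(2) show thesis by (intro that[of "k - 1"]) (auto simp: step_edge_def)
  qed
qed

lemma perfect_matching_of:
  assumes "1 \<le> d" "admissible d H s"
  shows "perfect_matching d H (matching_of d H s)"
  unfolding perfect_matching_def
proof (intro conjI ballI)
  show "matching_of d H s \<subseteq> snake_edges d H"
    using step_edge_in_snake[OF assms] by (auto simp: matching_of_def)
  fix v assume "v \<in> snake_vertices d H"
  then obtain k where "k \<le> Suc d" "v \<in> layer d H k"
    using snake_vertices_layers[OF assms(1)] by auto
  then obtain l where "l \<le> d" "v \<in> step_edge d H s l"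
    "\<And>m. m \<le> d \<Longrightarrow> v \<in> step_edge d H s m \<Longrightarrow> m = l"
    by (rule matching_of_covered[OF assms(1)]) blast
  then show "\<exists>!e. e \<in> matching_of d H s \<and> v \<in> e"
    unfolding matching_of_def by blast
qed

lemma up_of_matching_of:
  assumes "1 \<le> d" "1 \<le> j" "j \<le> d"
  shows "up_of H (matching_of d H s) j = s j"
proof
  assume "up_of H (matching_of d H s) j"
  then obtain u k where u: "Suc (level u) = j" "{u, se H j} = step_edge d H s k" "k \<le> d"
    by (auto simp: up_of_def matching_of_def)
  then have "level u = k \<or> level u = Suc k" "level (se H j) = k \<or> level (se H j) = Suc k"
    using in_step_edge_level[OF assms(1) u(3), of _ H s] by blast+
  then have "k = j - 1" using u(1) assms(2) level_corners(1)[of j H] by auto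
  moreover have "se H j \<in> step_edge d H s k" using u(2) by blast
  ultimately have "se H j = enter d H s j"
    using in_step_edge_level[OF assms(1) u(3), of "se H j" H s] assms level_corners(1)[of j H]
    by auto
  then show "s j" using assms by (auto simp: enter_def split: if_splits)
next
  assume "s j"
  then have "{leave H s (j - 1), se H j} = step_edge d H s (j - 1)"
    using assms by (auto simp: step_edge_def enter_def)
  then have "{leave H s (j - 1), se H j} \<in> matching_of d H s"
    using assms by (auto simp: matching_of_def)
  moreover have "Suc (level (leave H s (j - 1))) = j" using assms by (simp add: level_leave)
  ultimately show "up_of H (matching_of d H s) j" unfolding up_of_def by blast
qed

subsection \<open>Every perfect matching comes from orientations\<close>

text \<open>South and West sides of tile \<open>j\<close> go from level \<open>j - 1\<close> to
  level \<open>j\<close>, North and East sides from level \<open>j\<close> to level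
  \<open>j + 1\<close>. The last two conclusions exclude the vertex pairs forbidden by
  \<open>admissible\<close>.\<close>

lemma snake_edge_levels:
  assumes "1 \<le> d" "e \<in> snake_edges d H"
  obtains k u v where "k \<le> d" "u \<in> layer d H k" "v \<in> layer d H (Suc k)" "e = {u, v}"
    "1 \<le> k \<and> k < d \<and> H k = North_Pointing \<longrightarrow> \<not> (u = se H k \<and> v = nw H (Suc k))"
    "1 \<le> k \<and> k < d \<and> H k = East_Pointing \<longrightarrow> \<not> (u = nw H k \<and> v = se H (Suc k))"
proof -
  obtain j t where j: "1 \<le> j" "j \<le> d" "e = tile_edge H j t"
    using assms(2) by (auto simp: snake_edges_def)
  \<comment> \<open>\<open>ne H j\<close> is the SE corner of a tile glued above and the NW corner
    of a tile glued to the right, never the corner in the excluded pair.\<close>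
  have upper: "\<not> (H j = North_Pointing \<and> ne H j = nw H (Suc j))"
    "\<not> (H j = East_Pointing \<and> ne H j = se H (Suc j))"
    using north_glue(2)[OF j(1), of H] east_glue(2)[OF j(1), of H] by (metis nw_neq_se)+
  have lower: "\<not> (1 \<le> j - 1 \<and> H (j - 1) = North_Pointing \<and> sw H j = se H (j - 1))"
    "\<not> (1 \<le> j - 1 \<and> H (j - 1) = East_Pointing \<and> sw H j = nw H (j - 1))"
    using sw_Suc[of "j - 1" H] j(1) by auto
  have mid: "nw H j \<in> layer d H j" "se H j \<in> layer d H j"
    using j by (auto simp: layer_def)
  note sws = sw_in_layer[OF j(1,2), of H] and nes = ne_in_layer[OF j(1,2), of H]
  have j': "Suc (j - 1) = j" "j - 1 \<le> d" using j by auto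
  show thesis
  proof (cases t)
    case South
    then show thesis using j j' lower mid sws nw_neq_se
      by (intro that[of "j - 1" "sw H j" "se H j"]) auto
  next
    case West
    then show thesis using j j' lower mid sws nw_neq_se
      by (intro that[of "j - 1" "sw H j" "nw H j"]) auto
  next
    case North
    then show thesis using j upper mid nes nw_neq_se
      by (intro that[of j "nw H j" "ne H j"]) auto
  next
    case East
    then show thesis using j upper mid nes nw_neq_se
      by (intro that[of j "se H j" "ne H j"]) auto
  qed
qed

lemma snake_edge_layers:
  assumes "1 \<le> d" "e \<in> snake_edges d H"
  obtains k u v where "k \<le> d" "u \<in> layer d H k" "v \<in> layer d H (Suc k)" "e = {u, v}"
    "level u = k" "level v = Suc k"
proof -
  obtain k u v where *: "k \<le> d" "u \<in> layer d H k" "v \<in> layer d H (Suc k)" "e = {u, v}"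
    by (rule snake_edge_levels[OF assms]) blast
  then have "level u = k" "level v = Suc k"
    using level_layer[OF assms(1), of k u H] level_layer[OF assms(1), of "Suc k" v H] by auto
  with * show thesis by (rule that)
qed

text \<open>The matching is forced level by level: one vertex of an inner layer is already matched
  from below, so the other must be matched upwards, by the only edge of \<open>P\<close> between
  these two levels.\<close>

lemma perfect_matching_step:
  assumes "1 \<le> d" "perfect_matching d H P" "k \<le> d"
  shows "step_edge d H (up_of H P) k \<in> P \<and>
    (\<forall>e u v. e \<in> P \<longrightarrow> e = {u, v} \<longrightarrow> level u = k \<longrightarrow> level v = Suc k \<longrightarrow>
      e = step_edge d H (up_of H P) k)"
proof -
  define s where "s = up_of H P"
  have uniq: "e = f" if "e \<in> P" "f \<in> P" "v \<in> e" "v \<in> f" "v \<in> layer d H l" "l \<le> Suc d" for e f v l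
    using assms(2) that snake_vertices_layers[OF assms(1), of H]
    unfolding perfect_matching_def by blast
  have cover: "\<exists>e\<in>P. v \<in> e" if "v \<in> layer d H l" "l \<le> Suc d" for v l
    using assms(2) that snake_vertices_layers[OF assms(1), of H]
    unfolding perfect_matching_def by blast
  have PE: "P \<subseteq> snake_edges d H" using assms(2) by (auto simp: perfect_matching_def)
  \<comment> \<open>\<open>only\<close> and \<open>notbelow\<close> are what the previous level
    contributes: edges going up start at \<open>leave H s k\<close>, and this vertex is not matched
    downwards. Hence its own edge goes up, and every other upward edge shares this end with
    it.\<close>
  have main: "step_edge d H s k \<in> P \<and> (\<forall>e u v. e \<in> P \<longrightarrow> e = {u, v} \<longrightarrow> level u = k \<longrightarrow>
      level v = Suc k \<longrightarrow> e = step_edge d H s k)"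
    if k: "k \<le> d" and only: "\<And>e u v. e \<in> P \<Longrightarrow> e = {u, v} \<Longrightarrow> u \<in> layer d H k \<Longrightarrow>
        v \<in> layer d H (Suc k) \<Longrightarrow> u = leave H s k"
      and notbelow: "\<And>e u v. e \<in> P \<Longrightarrow> e = {u, v} \<Longrightarrow> leave H s k \<in> e \<Longrightarrow> Suc (level u) = k \<Longrightarrow>
        level v = k \<Longrightarrow> False" for k
  proof -
    have lk: "leave H s k \<in> layer d H k" using k by (auto simp: leave_def layer_def)
    obtain e where e: "e \<in> P" "leave H s k \<in> e" using cover[OF lk] k by auto
    have "e \<in> snake_edges d H" using e(1) PE by blast
    then obtain l u v where luv: "l \<le> d" "u \<in> layer d H l" "v \<in> layer d H (Suc l)" "e = {u, v}"
      and lev: "level u = l" "level v = Suc l"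
      by (rule snake_edge_layers[OF assms(1)])
    have "l = k"
    proof (rule ccontr)
      assume "l \<noteq> k"
      then have "Suc l = k" using e(2) luv(4) lev level_leave[of H s k] by auto
      then show False using notbelow[OF e(1) luv(4) e(2)] lev by auto
    qed
    then have u: "u = leave H s k" using only e luv by blast
    have all: "f = e" if "f \<in> P" "f = {u', v'}" "level u' = k" "level v' = Suc k" for f u' v'
    proof -
      have "f \<in> snake_edges d H" using that(1) PE by blast
      then obtain l' u2 v2 where luv2: "l' \<le> d" "u2 \<in> layer d H l'" "v2 \<in> layer d H (Suc l')"
        "f = {u2, v2}" and lev2: "level u2 = l'" "level v2 = Suc l'"
        by (rule snake_edge_layers[OF assms(1)])
      have "l' = k" using that(2-4) luv2(4) lev2 by (auto simp: doubleton_eq_iff)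
      then have "leave H s k \<in> f" using only[OF that(1) luv2(4)] luv2 by auto
      then show ?thesis using uniq[OF that(1) e(1) _ e(2) lk] k by auto
    qed
    have "v = enter d H s (Suc k)"
    proof (cases "Suc k = Suc d")
      case True
      then show ?thesis using luv(3) \<open>l = k\<close> by (auto simp: layer_def enter_def)
    next
      case False
      then have v: "v = nw H (Suc k) \<or> v = se H (Suc k)"
        using luv(3) \<open>l = k\<close> by (auto simp: layer_def)
      have "s (Suc k) \<longleftrightarrow> v = se H (Suc k)"
      proof
        assume "s (Suc k)"
        then obtain u' where u': "level u' = k" "{u', se H (Suc k)} \<in> P"
          by (auto simp: s_def up_of_def)
        then have "{u', se H (Suc k)} = e" using all[OF u'(2) refl u'(1)]
          by (simp add: level_corners)
        moreover have "se H (Suc k) \<noteq> u" using lev \<open>l = k\<close> level_corners(1)[of "Suc k" H] by auto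
        ultimately show "v = se H (Suc k)" using luv(4) by auto
      next
        assume "v = se H (Suc k)"
        then have "{u, se H (Suc k)} \<in> P" using e(1) luv(4) by simp
        then show "s (Suc k)" unfolding s_def up_of_def using lev \<open>l = k\<close> by blast
      qed
      then show ?thesis using v False by (auto simp: enter_def)
    qed
    then have "e = step_edge d H s k" using u luv(4) by (simp add: step_edge_def)
    then show ?thesis using e(1) all by blast
  qed
  show ?thesis
    using assms(3) unfolding s_def[symmetric]
  proof (induction k)
    case 0
    show ?case
      by (rule main) (simp_all add: layer_def leave_def del: sw.simps)
  next
    case (Suc k)
    have k: "k \<le> d" using Suc.prems by simp
    have IH: "step_edge d H s k \<in> P"
      "e \<in> P \<Longrightarrow> e = {u, v} \<Longrightarrow> level u = k \<Longrightarrow> level v = Suc k \<Longrightarrow> e = step_edge d H s k" for e u v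
      using Suc.IH[OF k] by blast+
    have ent: "enter d H s (Suc k) \<in> layer d H (Suc k)" using Suc.prems
      by (auto simp: enter_def layer_def)
    show ?case
    proof (rule main)
      show "Suc k \<le> d" by fact
      fix e u v assume e: "e \<in> P" "e = {u, v}"
      {
        \<comment> \<open>\<open>enter d H s (Suc k)\<close> is taken by step edge \<open>k\<close>,
          which does not reach level \<open>k + 2\<close>; an upward edge starts at the other vertex
          of the layer.\<close>
        assume uv: "u \<in> layer d H (Suc k)" "v \<in> layer d H (Suc (Suc k))"
        have "level v = Suc (Suc k)" using level_layer[OF assms(1) _ uv(2)] Suc.prems by auto
        then have "v \<notin> step_edge d H s k"
          using in_step_edge_level[OF assms(1), of k v H s] Suc.prems by auto
        then have "e \<noteq> step_edge d H s k" using e by auto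
        then have "u \<noteq> enter d H s (Suc k)"
          using uniq[OF e(1) IH(1) _ _ ent] e(2) Suc.prems by (auto simp: step_edge_def)
        then show "u = leave H s (Suc k)"
          using uv(1) layer_inner[of "Suc k" d H s] Suc.prems by auto
      }
      assume "leave H s (Suc k) \<in> e" "Suc (level u) = Suc k" "level v = Suc k"
      then have "leave H s (Suc k) \<in> step_edge d H s k" using IH(2)[OF e] by auto
      then show False
        using in_step_edge_level[OF assms(1), of k "leave H s (Suc k)" H s]
          enter_neq_leave[of "Suc k" d H s] Suc.prems by (auto simp: level_leave)
    qed
  qed
qed

lemma perfect_matching_eq_matching_of:
  assumes "1 \<le> d" "perfect_matching d H P"
  shows "matching_of d H (up_of H P) = P" "admissible d H (up_of H P)"
proof -
  note st = perfect_matching_step[OF assms]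
  have PE: "P \<subseteq> snake_edges d H" using assms(2) by (auto simp: perfect_matching_def)
  show "matching_of d H (up_of H P) = P"
  proof
    show "matching_of d H (up_of H P) \<subseteq> P" using st by (auto simp: matching_of_def)
    show "P \<subseteq> matching_of d H (up_of H P)"
    proof
      fix e assume e: "e \<in> P"
      have "e \<in> snake_edges d H" using e PE by blast
      then obtain l u v where luv: "l \<le> d" "u \<in> layer d H l" "v \<in> layer d H (Suc l)" "e = {u, v}"
        and "level u = l" "level v = Suc l"
        by (rule snake_edge_layers[OF assms(1)])
      then have "e = step_edge d H (up_of H P) l" using st[OF luv(1)] e luv(4) by blast
      then show "e \<in> matching_of d H (up_of H P)" using luv(1) by (auto simp: matching_of_def)
    qed
  qed
  show "admissible d H (up_of H P)"
    unfolding admissible_def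
  proof (intro ballI)
    fix j assume j: "j \<in> {1..<d}"
    define s where "s = up_of H P"
    \<comment> \<open>Admissibility holds because step edge \<open>j\<close> is an edge of the
      graph, hence not one of the excluded pairs.\<close>
    have "step_edge d H s j \<in> snake_edges d H" using st[of j] j PE s_def by auto
    then obtain k u v where k: "k \<le> d" "u \<in> layer d H k" "v \<in> layer d H (Suc k)"
      "step_edge d H s j = {u, v}"
      "1 \<le> k \<and> k < d \<and> H k = North_Pointing \<longrightarrow> \<not> (u = se H k \<and> v = nw H (Suc k))"
      "1 \<le> k \<and> k < d \<and> H k = East_Pointing \<longrightarrow> \<not> (u = nw H k \<and> v = se H (Suc k))"
      by (rule snake_edge_levels[OF assms(1)])
    have lev: "level u = k" "level v = Suc k"
      using level_layer[OF assms(1), of k u H] level_layer[OF assms(1), of "Suc k" v H] k by auto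
    have "u \<in> step_edge d H s j" "v \<in> step_edge d H s j" using k(4) by auto
    then have "u = leave H s j \<and> v = enter d H s (Suc j) \<and> k = j"
      using in_step_edge_level[OF assms(1), of j u H s] in_step_edge_level[OF assms(1), of j v H s]
        j lev by auto
    then show "if H j = North_Pointing then up_of H P j \<or> up_of H P (Suc j)
      else \<not> up_of H P j \<or> \<not> up_of H P (Suc j)"
      using k(5,6) j unfolding s_def[symmetric]
      by (cases "H j"; cases "s j"; cases "s (Suc j)") (auto simp: enter_def leave_def)
  qed
qed

subsection \<open>Orientations of the diagonals\<close>

text \<open>Position \<open>2 * m\<close> is where level \<open>m\<close> is left along a matching
  edge, position \<open>2 * m + 1\<close> where level \<open>m + 1\<close> is entered. The full path
  has positions \<open>0\<close> to \<open>2 * d + 1\<close>.\<close>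

definition path_vertex :: "nat \<Rightarrow> (nat \<Rightarrow> shape) \<Rightarrow> (nat \<Rightarrow> bool) \<Rightarrow> nat \<Rightarrow> vertex" where
  "path_vertex d H s k =
     (if even k then leave H s (k div 2) else enter d H s (Suc (k div 2)))"

lemma level_path_vertex:
  assumes "1 \<le> d" "k \<le> Suc (2 * d)"
  shows "level (path_vertex d H s k) = Suc k div 2"
proof (cases "even k")
  case True
  then show ?thesis by (auto simp: path_vertex_def level_leave)
next
  case False
  then obtain m where "k = Suc (2 * m)" by (auto elim: oddE)
  then show ?thesis using assms by (auto simp: path_vertex_def level_enter)
qed

text \<open>Two different positions of equal level are \<open>2 * j + 1\<close> and
  \<open>2 * j + 2\<close>, the ends of one diagonal.\<close>

lemma path_vertex_inj:
  assumes "1 \<le> d" "k \<le> Suc (2 * d)" "l \<le> Suc (2 * d)"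
    "path_vertex d H s k = path_vertex d H s l"
  shows "k = l"
proof (rule ccontr)
  assume ne: "k \<noteq> l"
  have lev: "Suc k div 2 = Suc l div 2"
    using assms level_path_vertex by metis
  have *: False if "m = Suc (2 * j)" "n = Suc m" "m \<le> Suc (2 * d)" "n \<le> Suc (2 * d)"
    "path_vertex d H s m = path_vertex d H s n" for m n j
    using that enter_neq_leave[of "Suc j" d H s] by (auto simp: path_vertex_def)
  show False
  proof (cases "even k")
    case True
    then obtain m where "k = 2 * m" by (auto elim: evenE)
    then have "k = Suc l" "l = Suc (2 * (m - 1))" using lev ne by presburger+
    then show False using *[of l "m - 1" k] assms by auto
  next
    case False
    then obtain m where "k = Suc (2 * m)" by (auto elim: oddE)
    then have "l = Suc k" using lev ne by presburger
    then show False using *[of k m l] assms \<open>k = Suc (2 * m)\<close> by auto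
  qed
qed

lemma alternating_path_exists:
  assumes "1 \<le> d"
  shows "alternating_path d H (matching_of d H s)
    (map (path_vertex d H s) [0..<Suc (Suc (2 * d))])" (is "alternating_path d H ?P ?vs")
proof -
  have nth: "?vs ! k = path_vertex d H s k" if "k < Suc (Suc (2 * d))" for k
    using that by (simp add: nth_append del: upt_Suc)
  have "distinct ?vs"
    using path_vertex_inj[OF assms] by (auto simp: distinct_map inj_on_def simp del: upt_Suc)
  moreover have "hd ?vs = sw H 1"
    by (simp add: hd_map path_vertex_def leave_def del: upt_Suc)
  moreover have "last ?vs = ne H d"
    by (simp add: path_vertex_def enter_def)
  moreover have "if even k then {?vs ! k, ?vs ! Suc k} \<in> ?P
      else \<exists>j\<in>{1..d}. {?vs ! k, ?vs ! Suc k} = {nw H j, se H j}" if "Suc k < length ?vs" for k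
  proof (cases "even k")
    case True
    then obtain m where "k = 2 * m" by (auto elim: evenE)
    then show ?thesis
      using that nth[of k] nth[of "Suc k"]
      by (simp add: path_vertex_def matching_of_def step_edge_def image_iff del: upt_Suc) auto
  next
    case False
    then obtain m where m: "k = Suc (2 * m)" by (auto elim: oddE)
    then have "{?vs ! k, ?vs ! Suc k} = {nw H (Suc m), se H (Suc m)}"
      using that nth[of k] nth[of "Suc k"]
      by (auto simp add: path_vertex_def enter_def leave_def simp del: upt_Suc)
    moreover have "Suc m \<in> {1..d}" using that m by auto
    ultimately show ?thesis using False by auto
  qed
  moreover have "?vs \<noteq> []" by simp
  ultimately show ?thesis
    unfolding alternating_path_def by blast
qed

text \<open>Every vertex forces the next: the matching edge at a vertex is unique, and a diagonal is
  determined by its level. The bound on \<open>k\<close> joins the induction because no diagonal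
  ends in the NE corner of tile \<open>d\<close>, at position \<open>2 * d + 1\<close>, so a path
  stops there.\<close>

lemma alternating_path_unique:
  assumes "1 \<le> d" "alternating_path d H (matching_of d H s) vs" "k < length vs"
  shows "k \<le> Suc (2 * d) \<and> vs ! k = path_vertex d H s k"
  using assms(3)
proof (induction k)
  case 0
  then show ?case
    using assms(2) by (auto simp: alternating_path_def path_vertex_def leave_def hd_conv_nth)
next
  case (Suc k)
  then have IH: "k \<le> Suc (2 * d)" "vs ! k = path_vertex d H s k" by auto
  have st: "if even k then {vs ! k, vs ! Suc k} \<in> matching_of d H s
      else \<exists>j\<in>{1..d}. {vs ! k, vs ! Suc k} = {nw H j, se H j}"
    using assms(2) Suc.prems unfolding alternating_path_def by blast
  show ?case
  proof (cases "even k")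
    case True
    then obtain m where m: "k = 2 * m" by (auto elim: evenE)
    then have md: "m \<le> d" using IH(1) by auto
    have vk: "vs ! k = leave H s m" using IH(2) m by (simp add: path_vertex_def)
    obtain l where l: "l \<le> d" "{vs ! k, vs ! Suc k} = step_edge d H s l"
      using st True by (auto simp: matching_of_def)
    have "l = m"
    proof (rule ccontr)
      assume "l \<noteq> m"
      then have "Suc l = m" "leave H s m = enter d H s m"
        using in_step_edge_level[OF assms(1) l(1), of "leave H s m" H s] l(2) vk
        by (auto simp: level_leave)
      then show False using enter_neq_leave[of m d H s] md by auto
    qed
    then have "vs ! Suc k = enter d H s (Suc m)"
      using l vk by (auto simp: step_edge_def doubleton_eq_iff)
    then show ?thesis using m md by (simp add: path_vertex_def)
  next
    case False
    then obtain m where m: "k = Suc (2 * m)" by (auto elim: oddE)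
    have vk: "vs ! k = enter d H s (Suc m)" using IH(2) m by (simp add: path_vertex_def)
    obtain j where j: "1 \<le> j" "j \<le> d" "{vs ! k, vs ! Suc k} = {nw H j, se H j}"
      using st False by auto
    have "vs ! k = nw H j \<or> vs ! k = se H j" using j(3) by (auto simp: doubleton_eq_iff)
    then have "level (vs ! k) = j" using level_corners[OF j(1), of H] by auto
    then have "j = Suc m" using vk level_enter[OF assms(1), of "Suc m" H s] IH(1) m by auto
    then have "vs ! Suc k = leave H s (Suc m)"
      using j vk by (auto simp: enter_def leave_def doubleton_eq_iff split: if_splits)
    then show ?thesis using m j \<open>j = Suc m\<close> by (simp add: path_vertex_def)
  qed
qed

lemma path_vertex_diagonal:
  assumes "1 \<le> d" "1 \<le> j" "j \<le> d" "Suc k \<le> Suc (2 * d)"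
    "level (path_vertex d H s k) = j" "level (path_vertex d H s (Suc k)) = j"
  shows "path_vertex d H s k = enter d H s j"
proof -
  have "Suc k div 2 = j" "Suc (Suc k) div 2 = j"
    using assms level_path_vertex[OF assms(1)] by simp_all
  then have "k = Suc (2 * (j - 1))" by presburger
  then show ?thesis using assms(2) by (simp add: path_vertex_def)
qed

text \<open>The orientation predicates quantify over all alternating paths: one direction uses
  uniqueness of the path (\<open>fwd\<close>), the other the explicit path
  \<open>vs\<close>.\<close>

lemma oriented_matching_of:
  assumes "1 \<le> d" "1 \<le> j" "j \<le> d"
  shows "oriented_up d H (matching_of d H s) j \<longleftrightarrow> s j" (is ?up)
    and "oriented_down d H (matching_of d H s) j \<longleftrightarrow> \<not> s j" (is ?down)
proof -
  let ?P = "matching_of d H s"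
  have fwd: "vs ! k = enter d H s j"
    if "alternating_path d H ?P vs" "Suc k < length vs" "level (vs ! k) = j" "level (vs ! Suc k) = j"
    for vs k
    using path_vertex_diagonal[OF assms, of k H s]
      alternating_path_unique[OF assms(1) that(1), of k]
      alternating_path_unique[OF assms(1) that(1), of "Suc k"] that by auto
  define vs where "vs = map (path_vertex d H s) [0..<Suc (Suc (2 * d))]"
  define k where "k = Suc (2 * (j - 1))"
  have vs: "alternating_path d H ?P vs"
    using alternating_path_exists[OF assms(1)] by (simp add: vs_def)
  have k: "Suc k < length vs" using assms by (simp add: vs_def k_def)
  then have "vs ! k = path_vertex d H s k" "vs ! Suc k = path_vertex d H s (Suc k)"
    by (simp_all add: vs_def nth_append del: upt_Suc)
  then have vsk: "vs ! k = enter d H s j" "vs ! Suc k = leave H s j"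
    using assms(2) by (simp_all add: path_vertex_def k_def)
  note lev = level_corners[OF assms(2), of H]
  show ?up
  proof
    assume "oriented_up d H ?P j"
    then show "s j" using fwd lev assms
      unfolding oriented_up_def enter_def by (metis Suc_n_not_le_n nw_neq_se(2))
  next
    assume "s j"
    then show "oriented_up d H ?P j"
      unfolding oriented_up_def using vs k vsk assms by (auto simp: enter_def leave_def)
  qed
  show ?down
  proof
    assume "oriented_down d H ?P j"
    then show "\<not> s j" using fwd lev assms
      unfolding oriented_down_def enter_def by (metis Suc_n_not_le_n nw_neq_se(2))
  next
    assume "\<not> s j"
    then show "oriented_down d H ?P j"
      unfolding oriented_down_def using vs k vsk assms by (auto simp: enter_def leave_def)
  qed
qed

subsection \<open>Good matchings\<close>

text \<open>A constant orientation serves as a witness that presents the cut edge as a step edge, so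
  that \<open>step_edge_eqD\<close> can compare it with the step edges of any
  \<open>s\<close>.\<close>

lemma first_cut_step: "1 \<le> d \<Longrightarrow> first_cut H = step_edge d H (\<lambda>_. True) 0"
  by (simp add: first_cut_def step_edge_first)

lemma last_cut_step: "1 \<le> d \<Longrightarrow> last_cut d H = step_edge d H (\<lambda>_. odd d) d"
  by (simp add: last_cut_def step_edge_last)

lemma first_cut_iff:
  assumes "1 \<le> d"
  shows "first_cut H = step_edge d H s 0 \<longleftrightarrow> s 1"
    and "first_cut H \<in> matching_of d H s \<longleftrightarrow> s 1"
proof -
  have *: "k = 0 \<and> s 1" if "step_edge d H (\<lambda>_. True) 0 = step_edge d H s k" "k \<le> d" for k
    using step_edge_eqD[OF assms _ that(2) that(1)] assms
    by (auto simp: enter_def split: if_splits)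
  have **: "s 1 \<Longrightarrow> first_cut H = step_edge d H s 0"
    using assms by (simp add: first_cut_def step_edge_first)
  show "first_cut H = step_edge d H s 0 \<longleftrightarrow> s 1"
    using *[of 0] ** first_cut_step[OF assms] by auto
  show "first_cut H \<in> matching_of d H s \<longleftrightarrow> s 1"
    using * ** first_cut_step[OF assms] by (auto simp: matching_of_def)
qed

lemma last_cut_iff:
  assumes "1 \<le> d"
  shows "last_cut d H = step_edge d H s d \<longleftrightarrow> (s d \<longleftrightarrow> odd d)"
    and "last_cut d H \<in> matching_of d H s \<longleftrightarrow> (s d \<longleftrightarrow> odd d)"
proof -
  have *: "k = d \<and> (s d \<longleftrightarrow> odd d)"
    if "step_edge d H (\<lambda>_. odd d) d = step_edge d H s k" "k \<le> d" for k
    using step_edge_eqD(1,2)[OF assms _ that(2) that(1)] assms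
    by (auto simp: leave_def split: if_splits)
  have **: "(s d \<longleftrightarrow> odd d) \<Longrightarrow> last_cut d H = step_edge d H s d"
    using assms by (simp add: last_cut_def step_edge_last)
  show "last_cut d H = step_edge d H s d \<longleftrightarrow> (s d \<longleftrightarrow> odd d)"
    using *[of d] ** last_cut_step[OF assms] by auto
  show "last_cut d H \<in> matching_of d H s \<longleftrightarrow> (s d \<longleftrightarrow> odd d)"
    using * ** last_cut_step[OF assms] by (auto simp: matching_of_def)
qed

lemma first_neq_last_cut: "1 \<le> d \<Longrightarrow> first_cut H \<noteq> last_cut d H"
  using step_edge_eqD(1)[of d 0 d H "\<lambda>_. True" "\<lambda>_. odd d"]
  by (auto simp: first_cut_step last_cut_step)

text \<open>The last copy of the cut edge is either removed or absent from \<open>P\<close>, and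
  \<open>band_edge\<close> fixes all other edges.\<close>

lemma descended_eq:
  "descended d H P = P - {if last_cut d H \<in> P then last_cut d H else first_cut H}"
proof -
  let ?R = "P - {if last_cut d H \<in> P then last_cut d H else first_cut H}"
  have "band_edge d H ` ?R = id ` ?R"
    by (rule image_cong) (auto simp: band_edge_def split: if_splits)
  then show ?thesis by (simp add: descended_def)
qed

text \<open>The corners have levels \<open>0\<close> and \<open>1\<close>, the ends of the last cut
  edge have levels \<open>d\<close> and \<open>d + 1\<close>. For \<open>d = 1\<close> the end on
  level \<open>1\<close> is the NW corner.\<close>

lemma cut_vertices_disjoint:
  assumes "1 \<le> d" "v \<in> {sw H 1, se H 1}"
  shows "v \<notin> last_cut d H"
proof
  assume "v \<in> last_cut d H"
  then have "level v = d \<and> v = leave H (\<lambda>_. odd d) d \<or> level v = Suc d"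
    using in_step_edge_level[OF assms(1) order_refl, of v H "\<lambda>_. odd d"]
    by (auto simp: last_cut_step[OF assms(1)])
  moreover have "v = sw H 1 \<and> level v = 0 \<or> v = se H 1 \<and> level v = 1"
    using assms(2) level_corners(1)[of 1 H] by auto
  ultimately show False
    using assms(1) by (auto simp: leave_def split: if_splits)
qed

lemma ne_in_last_cut: "ne H d \<in> last_cut d H"
  by (simp add: last_cut_def)

text \<open>If both copies of the cut edge lie in \<open>P\<close>, one survives as
  \<open>b\<close>. If just one does, it is removed, and the rest of \<open>P\<close> still covers
  both ends of the other copy, which gives \<open>matched_beside\<close> for that copy.\<close>

lemma good_matching_iff:
  assumes "1 \<le> d"
  shows "good_matching d H P \<longleftrightarrow>
    perfect_matching d H P \<and> (first_cut H \<in> P \<or> last_cut d H \<in> P)"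
proof -
  have "first_cut H \<in> descended d H P \<or>
      first_cut H \<notin> descended d H P \<and> matched_beside d H (descended d H P) (first_cut H) \<or>
      first_cut H \<notin> descended d H P \<and> matched_beside d H (descended d H P) (last_cut d H)"
    if P: "perfect_matching d H P" "first_cut H \<in> P \<or> last_cut d H \<in> P"
  proof -
    have cover: "\<exists>e\<in>P. v \<in> e" if "v \<in> snake_vertices d H" for v
      using P(1) that by (auto simp: perfect_matching_def)
    have verts: "{sw H 1, se H 1, nw H d, se H d, ne H d} \<subseteq> snake_vertices d H"
    proof -
      have "1 \<in> {1..d}" "d \<in> {1..d}" using assms by auto
      then show ?thesis unfolding snake_vertices_def by blast
    qed
    consider "first_cut H \<in> P" "last_cut d H \<in> P" | "first_cut H \<notin> P" "last_cut d H \<in> P"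
      | "first_cut H \<in> P" "last_cut d H \<notin> P" using P(2) by blast
    then show ?thesis
    proof cases
      case 1
      then show ?thesis using first_neq_last_cut[OF assms, of H] by (auto simp: descended_eq)
    next
      case 2
      have "\<exists>e\<in>descended d H P. \<exists>u\<in>e \<inter> first_cut H. band_vertex d H u = v"
        if v: "v \<in> {sw H 1, se H 1}" for v
      proof -
        have "v \<in> snake_vertices d H" using v verts by blast
        then obtain e where e: "e \<in> P" "v \<in> e" using cover by blast
        have nl: "v \<notin> last_cut d H" by (rule cut_vertices_disjoint[OF assms v])
        then have "e \<in> descended d H P" using e 2 by (auto simp: descended_eq)
        moreover have "v \<in> e \<inter> first_cut H" using e v by (auto simp: first_cut_def)
        moreover have "band_vertex d H v = v"
          using nl ne_in_last_cut[of H d] by (auto simp: band_vertex_def)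
        ultimately show ?thesis by blast
      qed
      then show ?thesis using 2 by (simp add: matched_beside_def descended_eq)
    next
      case 3
      \<comment> \<open>The end of the last cut edge other than the NE corner; the identification
        sends it to \<open>sw H 1\<close>.\<close>
      define u where "u = leave H (\<lambda>_. odd d) d"
      have last: "last_cut d H = {u, ne H d}"
        using assms by (simp add: last_cut_step step_edge_def enter_def u_def)
      have un: "u \<noteq> ne H d"
        using level_leave[of H "\<lambda>_. odd d" d] level_corners(3)[OF assms, of H] by (auto simp: u_def)
      have covered: "\<exists>e\<in>descended d H P. v \<in> e" if v: "v \<in> last_cut d H" for v
      proof -
        have "v \<in> snake_vertices d H" using v verts assms unfolding last
          by (auto simp: u_def leave_def split: if_splits)
        then obtain e where e: "e \<in> P" "v \<in> e" using cover by blast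
        have "v \<notin> {sw H 1, se H 1}" using cut_vertices_disjoint[OF assms] v by blast
        then have "e \<noteq> first_cut H" using e by (auto simp: first_cut_def)
        then show ?thesis using e 3 by (auto simp: descended_eq)
      qed
      have "band_vertex d H u = sw H 1" "band_vertex d H (ne H d) = se H 1"
        using last un by (auto simp: band_vertex_def)
      then have "matched_beside d H (descended d H P) (last_cut d H)"
        using covered[of u] covered[of "ne H d"] last by (auto simp: matched_beside_def)
      then show ?thesis using 3 by (simp add: descended_eq)
    qed
  qed
  then show ?thesis unfolding good_matching_def Let_def by blast
qed

subsection \<open>Labels\<close>

text \<open>By coordinates, tiles sharing a side coincide or differ by one unit step. A tile number
  is one more than the level of the SW corner, so the displaced tile is a neighbour in the sequence,
  and the shape tells where it is glued.\<close>

lemma tile_edge_eq_cases: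
  assumes "1 \<le> j" "1 \<le> j'" "tile_edge H j t = tile_edge H j' t'"
  shows "j = j' \<and> t = t' \<or>
    j' = Suc j \<and> (H j = North_Pointing \<and> t = North \<and> t' = South \<or>
                  H j = East_Pointing \<and> t = East \<and> t' = West) \<or>
    j = Suc j' \<and> (H j' = North_Pointing \<and> t' = North \<and> t = South \<or>
                  H j' = East_Pointing \<and> t' = East \<and> t = West)"
proof -
  obtain p q p' q' where pq: "sw H j = (p, q)" "sw H j' = (p', q')" by (metis surj_pair)
  have lev: "j = Suc (p + q)" "j' = Suc (p' + q')"
    using level_sw[of H "j - 1"] level_sw[of H "j' - 1"] assms(1,2) pq by (auto simp: level_def)
  have suc: "sw H (Suc j) = (if H j = North_Pointing then (p, Suc q) else (Suc p, q))"
    "sw H (Suc j') = (if H j' = North_Pointing then (p', Suc q') else (Suc p', q'))"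
    using sw_Suc[OF assms(1), of H] sw_Suc[OF assms(2), of H] pq by (auto simp: nw_def se_def)
  have "p' = p \<and> q' = q \<and> t = t' \<or>
      p' = p \<and> q' = Suc q \<and> t = North \<and> t' = South \<or>
      p' = Suc p \<and> q' = q \<and> t = East \<and> t' = West \<or>
      p = p' \<and> q = Suc q' \<and> t' = North \<and> t = South \<or>
      p = Suc p' \<and> q = q' \<and> t' = East \<and> t = West"
    using assms(3) pq
    by (cases t; cases t'; auto simp: se_def nw_def ne_def doubleton_eq_iff)
  then show ?thesis
    using pq suc lev
    by (elim disjE conjE) (auto split: if_splits intro: shape.exhaust)
qed

lemma edge_label_tile_edge:
  assumes "1 \<le> j" "j \<le> d"
  shows "edge_label d H i a c (tile_edge H j t) = side_label d H i a c j t"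
  unfolding edge_label_def
proof (rule the_equality)
  show "\<exists>j'\<in>{1..d}. \<exists>t'. tile_edge H j t = tile_edge H j' t' \<and>
      side_label d H i a c j t = side_label d H i a c j' t'"
    using assms by (intro bexI[of _ j]) auto
  fix l assume "\<exists>j'\<in>{1..d}. \<exists>t'. tile_edge H j t = tile_edge H j' t' \<and>
      l = side_label d H i a c j' t'"
  then obtain j' t' where j': "1 \<le> j'" "j' \<le> d" "tile_edge H j t = tile_edge H j' t'"
    "l = side_label d H i a c j' t'" by auto
  show "l = side_label d H i a c j t"
    using tile_edge_eq_cases[OF assms(1) j'(1,3)] assms j'(1,2) unfolding j'(4)
    by (elim disjE conjE) simp_all
qed

subsection \<open>States\<close>

text \<open>
  The state of tile \<open>j\<close> is the orientation of its diagonal, reversed for even \<open>j\<close>: it is \<open>True\<close> iff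
  the diagonal would be \<open>L_oriented\<close> for shear coordinate \<open>-1\<close>. A state sequence is given by the set
  \<open>T\<close> of the tiles in state \<open>True\<close>.
\<close>

definition orient :: "nat set \<Rightarrow> nat \<Rightarrow> bool" where
  "orient T j \<longleftrightarrow> (odd j \<longleftrightarrow> j \<in> T)"

text \<open>Weight of step edge \<open>k\<close> by the states of tiles \<open>k\<close> and
  \<open>k + 1\<close>, with \<open>0\<close> for the forbidden pair so that sums may run over all
  state sets. Reversing the even diagonals makes the table depend on the type of \<open>k\<close>
  alone and not on its parity.\<close>

definition trans_weight ::
  "(nat \<Rightarrow> shape) \<Rightarrow> (nat \<Rightarrow> 'l) \<Rightarrow> (nat \<Rightarrow> 'l) \<Rightarrow> ('l \<Rightarrow> 'k::field) \<Rightarrow> nat \<Rightarrow> bool \<Rightarrow> bool \<Rightarrow> 'k"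
where
  "trans_weight H i a x k p q =
     (if first_type H k
      then (if p then if q then x (i k) else x (a k) else if q then 0 else x (i (Suc k)))
      else (if p then if q then x (i (Suc k)) else 0 else if q then x (a k) else x (i k)))"

text \<open>State \<open>True\<close> at tile \<open>1\<close> or tile \<open>d\<close> means that
  the copy of the cut edge there is in the matching. One copy is removed and the value is the weight
  of the other end edge; \<open>0\<close> discards matchings with neither copy.\<close>

definition end_weight ::
  "nat \<Rightarrow> (nat \<Rightarrow> 'l) \<Rightarrow> 'l \<Rightarrow> ('l \<Rightarrow> 'k::field) \<Rightarrow> bool \<Rightarrow> bool \<Rightarrow> 'k"
where
  "end_weight d i c x p q =
     (if p then if q then x c else x (i 1) else if q then x (i d) else 0)"

definition tile_weight ::
  "(nat \<Rightarrow> 'l) \<Rightarrow> ('l \<Rightarrow> int) \<Rightarrow> ('l \<Rightarrow> 'k::field) \<Rightarrow> nat \<Rightarrow> bool \<Rightarrow> 'k"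
where
  "tile_weight i bT y k p = (if p = (bT (i k) = 1) then 1 else y (i k))"

text \<open>Parity alternates at every step, so whether the shape agrees with it changes exactly
  when a shape is repeated, as the type does.\<close>

lemma first_type_iff: "1 \<le> k \<Longrightarrow> first_type H k \<longleftrightarrow> (H k = North_Pointing \<longleftrightarrow> odd k)"
proof (induction k rule: nat_induct_at_least)
  case (Suc n)
  then obtain m where "n = Suc m" by (cases n) auto
  with Suc show ?case by (cases "H (Suc m)"; cases "H (Suc (Suc m))") auto
qed simp

lemma trans_weight_zero:
  assumes "\<not> admissible d H (orient T)"
  shows "\<exists>k\<in>{1..<d}. trans_weight H i a x k (k \<in> T) (Suc k \<in> T) = 0"
proof -
  obtain k where "k \<in> {1..<d}" "\<not> (if H k = North_Pointing then orient T k \<or> orient T (Suc k)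
      else \<not> orient T k \<or> \<not> orient T (Suc k))"
    using assms by (auto simp: admissible_def)
  then show ?thesis
    by (intro bexI[of _ k])
      (auto simp: trans_weight_def first_type_iff orient_def split: if_splits)
qed

section \<open>Weights of a matching in terms of states\<close>

lemma step_edge_weight:
  assumes "1 \<le> k" "k < d" "admissible d H (orient T)"
  shows "x (edge_label d H i a c (step_edge d H (orient T) k)) =
    trans_weight H i a x k (k \<in> T) (Suc k \<in> T)"
proof -
  have adm: "if H k = North_Pointing then orient T k \<or> orient T (Suc k)
      else \<not> orient T k \<or> \<not> orient T (Suc k)"
    using bspec[OF assms(3)[unfolded admissible_def], of k] assms(1,2) by simp
  have lab: "edge_label d H i a c (tile_edge H k t) = side_label d H i a c k t"
    "edge_label d H i a c (tile_edge H (Suc k) t) = side_label d H i a c (Suc k) t" for t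
    using assms by (simp_all add: edge_label_tile_edge)
  show ?thesis
  proof (cases "H k")
    case North_Pointing
    then show ?thesis
      using step_edge_north[of k d H "orient T"] assms(1,2) adm
      by (auto simp: lab trans_weight_def first_type_iff orient_def simp del: tile_edge.simps)
  next
    case East_Pointing
    then show ?thesis
      using step_edge_east[of k d H "orient T"] assms(1,2) adm
      by (auto simp: lab trans_weight_def first_type_iff orient_def simp del: tile_edge.simps)
  qed
qed

lemma x_weight_matching_of:
  assumes "1 \<le> d" "admissible d H (orient T)" "1 \<in> T \<or> d \<in> T"
  shows "x_weight d H i a c x (matching_of d H (orient T)) =
    (\<Prod>k\<in>{1..<d}. trans_weight H i a x k (k \<in> T) (Suc k \<in> T)) *
    end_weight d i c x (1 \<in> T) (d \<in> T)"
proof -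
  let ?E = "step_edge d H (orient T)"
  let ?w = "\<lambda>k. x (edge_label d H i a c (?E k))"
  \<comment> \<open>Indices of the surviving step edges. If \<open>d\<close> is in \<open>T\<close>,
    step edge \<open>d\<close> is the last cut edge and is removed; otherwise \<open>1\<close> is in
    \<open>T\<close>, and step edge \<open>0\<close>, the first cut edge, is removed.\<close>
  let ?K = "if d \<in> T then {..<d} else {1..d}"
  have first: "first_cut H = ?E 0" if "1 \<in> T"
    using first_cut_iff(1)[OF assms(1), of H "orient T"] that by (simp add: orient_def)
  have last: "last_cut d H = ?E d" if "d \<in> T"
    using last_cut_iff(1)[OF assms(1), of H "orient T"] that by (simp add: orient_def)
  have last_in: "last_cut d H \<in> matching_of d H (orient T) \<longleftrightarrow> d \<in> T"
    using last_cut_iff(2)[OF assms(1), of H "orient T"] by (auto simp: orient_def)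
  have inj: "inj_on ?E {..d}" by (rule inj_step_edge[OF assms(1)])
  have "descended d H (matching_of d H (orient T)) = ?E ` {..d} - ?E ` (if d \<in> T then {d} else {0})"
    using assms(3) unfolding descended_eq last_in
    by (cases "d \<in> T") (simp_all add: first last matching_of_def)
  also have "\<dots> = ?E ` ({..d} - (if d \<in> T then {d} else {0}))"
    using inj by (intro inj_on_image_set_diff[symmetric]) auto
  also have "{..d} - (if d \<in> T then {d} else {0}) = ?K" by auto
  finally have K: "descended d H (matching_of d H (orient T)) = ?E ` ?K" .
  have "inj_on ?E ?K" by (rule inj_on_subset[OF inj]) auto
  then have "x_weight d H i a c x (matching_of d H (orient T)) = prod ?w ?K"
    unfolding x_weight_def K by (simp only: prod.reindex o_def)
  also have "\<dots> = prod ?w {1..<d} * (if d \<in> T then ?w 0 else ?w d)"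
  proof -
    have "{..<d} = insert 0 {1..<d}" "{1..d} = insert d {1..<d}" using assms(1) by auto
    then show ?thesis by (simp add: mult.commute)
  qed
  also have "prod ?w {1..<d} = (\<Prod>k\<in>{1..<d}. trans_weight H i a x k (k \<in> T) (Suc k \<in> T))"
    using assms(2) by (intro prod.cong) (auto simp: step_edge_weight)
  also have "(if d \<in> T then ?w 0 else ?w d) = end_weight d i c x (1 \<in> T) (d \<in> T)"
    using assms(1,3)
    by (auto simp: step_edge_first step_edge_last edge_label_tile_edge orient_def end_weight_def
        simp del: tile_edge.simps)
  finally show ?thesis .
qed

lemma y_weight_matching_of:
  assumes "1 \<le> d" "\<forall>j\<in>{1..d}. bT (i j) \<in> {1, -1}"
  shows "y_weight d H i bT y (matching_of d H (orient T)) =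
    (\<Prod>k\<in>{1..d}. tile_weight i bT y k (k \<in> T))"
proof -
  have "L_oriented d H i bT (matching_of d H (orient T)) j \<longleftrightarrow> (j \<in> T \<longleftrightarrow> bT (i j) = -1)"
    if "j \<in> {1..d}" for j
    using oriented_matching_of[OF assms(1), of j H "orient T"] bspec[OF assms(2) that] that
    by (auto simp: L_oriented_def orient_def)
  then show ?thesis
    unfolding y_weight_def using assms(2)
    by (subst prod.inter_filter) (auto intro!: prod.cong simp: tile_weight_def)
qed

section \<open>State sets parametrize the good matchings\<close>

lemma matching_of_cong:
  assumes "\<And>j. 1 \<le> j \<Longrightarrow> j \<le> d \<Longrightarrow> s j = s' j"
  shows "matching_of d H s = matching_of d H s'"
proof -
  have "step_edge d H s k = step_edge d H s' k" if "k \<le> d" for k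
    using that assms by (auto simp: step_edge_def enter_def leave_def)
  then show ?thesis by (auto simp: matching_of_def)
qed

lemma admissible_cong:
  assumes "\<And>j. 1 \<le> j \<Longrightarrow> j \<le> d \<Longrightarrow> s j = s' j"
  shows "admissible d H s = admissible d H s'"
  using assms by (auto simp: admissible_def)

text \<open>\<open>orient\<close> compares membership with parity and is its own inverse, so applied
  to the set of upward diagonals it yields the state set. Restriction to \<open>{1..d}\<close> makes
  this set unique.\<close>

lemma good_matching_sum:
  assumes "1 \<le> d"
  shows "(\<Sum>P | good_matching d H P. f P) =
    (\<Sum>T | T \<subseteq> {1..d} \<and> admissible d H (orient T) \<and> (1 \<in> T \<or> d \<in> T).
      f (matching_of d H (orient T)))"
proof (rule sum.reindex_bij_witness[of _ "\<lambda>T. matching_of d H (orient T)"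
      "\<lambda>P. {j \<in> {1..d}. orient {j. up_of H P j} j}"])
  fix P assume P: "P \<in> {P. good_matching d H P}"
  let ?T = "{j \<in> {1..d}. orient {j. up_of H P j} j}"
  have T: "orient ?T j = up_of H P j" if "1 \<le> j" "j \<le> d" for j
    using that by (auto simp: orient_def)
  have pm: "perfect_matching d H P" using P good_matching_iff[OF assms] by simp
  show eq: "matching_of d H (orient ?T) = P"
    using matching_of_cong[OF T] perfect_matching_eq_matching_of(1)[OF assms pm] by simp
  have "admissible d H (orient ?T)"
    using admissible_cong[OF T] perfect_matching_eq_matching_of(2)[OF assms pm] by simp
  moreover have "orient ?T 1 \<or> (orient ?T d \<longleftrightarrow> odd d)"
    using P good_matching_iff[OF assms] first_cut_iff(2)[OF assms, of H "orient ?T"]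
      last_cut_iff(2)[OF assms, of H "orient ?T"] unfolding eq by simp
  then have "1 \<in> ?T \<or> d \<in> ?T" unfolding orient_def[of ?T] by auto
  ultimately show "?T \<in> {T. T \<subseteq> {1..d} \<and> admissible d H (orient T) \<and> (1 \<in> T \<or> d \<in> T)}"
    by blast
  show "f (matching_of d H (orient ?T)) = f P" by (simp only: eq)
next
  fix T assume T: "T \<in> {T. T \<subseteq> {1..d} \<and> admissible d H (orient T) \<and> (1 \<in> T \<or> d \<in> T)}"
  show "{j \<in> {1..d}. orient {j. up_of H (matching_of d H (orient T)) j} j} = T"
    using T up_of_matching_of[OF assms, of _ H "orient T"] by (auto simp: orient_def)
  show "matching_of d H (orient T) \<in> {P. good_matching d H P}"
    using T perfect_matching_of[OF assms] first_cut_iff(2)[OF assms, of H "orient T"]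
      last_cut_iff(2)[OF assms, of H "orient T"] good_matching_iff[OF assms]
    by (auto simp: orient_def)
qed

subsection \<open>The transfer matrices\<close>

text \<open>Entry \<open>(p, q)\<close> of the product of the matrices \<open>g 1\<close> to
  \<open>g n\<close> indexed by \<open>bool\<close>.\<close>

fun chain_sum :: "(nat \<Rightarrow> bool \<Rightarrow> bool \<Rightarrow> 'k::field) \<Rightarrow> bool \<Rightarrow> nat \<Rightarrow> bool \<Rightarrow> 'k" where
  "chain_sum g p 0 q = of_bool (p = q)"
| "chain_sum g p (Suc n) q = (\<Sum>r\<in>UNIV. chain_sum g p n r * g (Suc n) r q)"

text \<open>\<open>n\<close> transitions involve \<open>n + 1\<close> tiles. In the induction step
  the state of the last tile is prescribed, so deleting that tile is a bijection; the remaining sets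
  are grouped by the state \<open>r\<close> of the tile before it.\<close>

lemma chain_sum_eq:
  "(\<Sum>T | T \<subseteq> {1..Suc n} \<and> (1 \<in> T \<longleftrightarrow> p) \<and> (Suc n \<in> T \<longleftrightarrow> q).
      \<Prod>k\<in>{1..n}. g k (k \<in> T) (Suc k \<in> T)) = chain_sum g p n q"
proof (induction n arbitrary: q)
  case 0
  have "{T. T \<subseteq> {1..Suc 0} \<and> (1 \<in> T \<longleftrightarrow> p) \<and> (Suc 0 \<in> T \<longleftrightarrow> q)} =
      (if p = q then {if p then {1} else {}} else {})"
    by (auto simp: subset_singleton_iff)
  then show ?case by simp
next
  case (Suc n)
  let ?A = "{T. T \<subseteq> {1..Suc n} \<and> (1 \<in> T \<longleftrightarrow> p)}"
  let ?f = "\<lambda>T. (\<Prod>k\<in>{1..n}. g k (k \<in> T) (Suc k \<in> T)) * g (Suc n) (Suc n \<in> T) q"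
  have "(\<Sum>T | T \<subseteq> {1..Suc (Suc n)} \<and> (1 \<in> T \<longleftrightarrow> p) \<and> (Suc (Suc n) \<in> T \<longleftrightarrow> q).
      \<Prod>k\<in>{1..Suc n}. g k (k \<in> T) (Suc k \<in> T)) = sum ?f ?A"
  proof (rule sum.reindex_bij_witness[of _ "\<lambda>T. if q then insert (Suc (Suc n)) T else T"
        "\<lambda>T. T - {Suc (Suc n)}"])
    fix T assume T: "T \<in> {T. T \<subseteq> {1..Suc (Suc n)} \<and> (1 \<in> T \<longleftrightarrow> p) \<and> (Suc (Suc n) \<in> T \<longleftrightarrow> q)}"
    then show "(if q then insert (Suc (Suc n)) (T - {Suc (Suc n)}) else T - {Suc (Suc n)}) = T"
      by auto
    show "T - {Suc (Suc n)} \<in> ?A" using T by (auto simp: le_Suc_eq)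
    have "(\<Prod>k\<in>{1..n}. g k (k \<in> T - {Suc (Suc n)}) (Suc k \<in> T - {Suc (Suc n)})) =
        (\<Prod>k\<in>{1..n}. g k (k \<in> T) (Suc k \<in> T))"
      by (intro prod.cong) auto
    then show "?f (T - {Suc (Suc n)}) = (\<Prod>k\<in>{1..Suc n}. g k (k \<in> T) (Suc k \<in> T))"
      using T by simp
  next
    fix T assume T: "T \<in> ?A"
    then have "Suc (Suc n) \<notin> T" by auto
    with T show "(if q then insert (Suc (Suc n)) T else T) - {Suc (Suc n)} = T"
      "(if q then insert (Suc (Suc n)) T else T)
        \<in> {T. T \<subseteq> {1..Suc (Suc n)} \<and> (1 \<in> T \<longleftrightarrow> p) \<and> (Suc (Suc n) \<in> T \<longleftrightarrow> q)}"
      by (auto simp: le_Suc_eq)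
  qed
  also have "\<dots> = (\<Sum>r\<in>UNIV. sum ?f {T \<in> ?A. (Suc n \<in> T) = r})"
    by (rule sum.group[symmetric]) auto
  also have "\<dots> = (\<Sum>r\<in>UNIV. chain_sum g p n r * g (Suc n) r q)"
  proof (rule sum.cong[OF refl])
    fix r
    have "sum ?f {T \<in> ?A. (Suc n \<in> T) = r} =
        (\<Sum>T | T \<subseteq> {1..Suc n} \<and> (1 \<in> T \<longleftrightarrow> p) \<and> (Suc n \<in> T \<longleftrightarrow> r).
          (\<Prod>k\<in>{1..n}. g k (k \<in> T) (Suc k \<in> T)) * g (Suc n) r q)"
      by (rule sum.cong) auto
    then show "sum ?f {T \<in> ?A. (Suc n \<in> T) = r} = chain_sum g p n r * g (Suc n) r q"
      by (simp only: sum_distrib_right[symmetric] Suc.IH)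
  qed
  finally show ?case by simp
qed

lemma sum_end_states:
  "(\<Sum>T | T \<subseteq> {1..Suc n}. (\<Prod>k\<in>{1..n}. g k (k \<in> T) (Suc k \<in> T)) * h (1 \<in> T) (Suc n \<in> T)) =
    (\<Sum>(p, q)\<in>UNIV. chain_sum g p n q * h p q)"
proof -
  let ?f = "\<lambda>T. (\<Prod>k\<in>{1..n}. g k (k \<in> T) (Suc k \<in> T)) * h (1 \<in> T) (Suc n \<in> T)"
  let ?A = "{T. T \<subseteq> {1..Suc n}}"
  have "sum ?f ?A = (\<Sum>r\<in>UNIV. sum ?f {T \<in> ?A. (1 \<in> T, Suc n \<in> T) = r})"
    by (rule sum.group[symmetric]) auto
  also have "\<dots> = (\<Sum>(p, q)\<in>UNIV. chain_sum g p n q * h p q)"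
  proof (rule sum.cong[OF refl])
    fix r :: "bool \<times> bool"
    obtain p q where r: "r = (p, q)" by (cases r)
    have "sum ?f {T \<in> ?A. (1 \<in> T, Suc n \<in> T) = r} =
        (\<Sum>T | T \<subseteq> {1..Suc n} \<and> (1 \<in> T \<longleftrightarrow> p) \<and> (Suc n \<in> T \<longleftrightarrow> q).
          (\<Prod>k\<in>{1..n}. g k (k \<in> T) (Suc k \<in> T)) * h p q)"
      by (rule sum.cong) (auto simp: r)
    then show "sum ?f {T \<in> ?A. (1 \<in> T, Suc n \<in> T) = r} =
        (case r of (p, q) \<Rightarrow> chain_sum g p n q * h p q)"
      by (simp only: r sum_distrib_right[symmetric] chain_sum_eq prod.case)
  qed
  finally show ?thesis .
qed

definition state_index :: "bool \<Rightarrow> 2" where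
  "state_index p = (if p then 1 else 2)"

lemma mat22_nth [simp]:
  "mat22 p q r s $ 1 $ 1 = p" "mat22 p q r s $ 1 $ 2 = q"
  "mat22 p q r s $ 2 $ 1 = r" "mat22 p q r s $ 2 $ 2 = s"
  by (simp_all add: mat22_def)

text \<open>
  The diagonal change of basis, which multiplies the second basis vector at tile \<open>k\<close> by
  \<open>x (i k)\<close>, and the scaling by \<open>x (i k)\<close> turn the matrices of the statement into transfer matrices.
\<close>

lemma chain_sum_band_matrix:
  fixes x y :: "'l \<Rightarrow> 'k::field"
  assumes "\<forall>j\<in>{1..Suc n}. x (i j) \<noteq> 0"
  shows "chain_sum (\<lambda>k p q. trans_weight H i a x k p q * tile_weight i bT y k p) p n q =
    (\<Prod>k\<in>{1..n}. x (i k)) * (if q then 1 else x (i (Suc n))) / (if p then 1 else x (i 1)) *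
    band_matrix H i a bT x y (Suc n) $ state_index q $ state_index p"
  using assms
proof (induction n arbitrary: q)
  case 0
  then show ?case by (auto simp: state_index_def mat_def)
next
  case (Suc n)
  then have nz: "x (i (Suc n)) \<noteq> 0" "x (i (Suc (Suc n))) \<noteq> 0" "x (i 1) \<noteq> 0" by auto
  have IH: "chain_sum (\<lambda>k p q. trans_weight H i a x k p q * tile_weight i bT y k p) p n q =
    (\<Prod>k\<in>{1..n}. x (i k)) * (if q then 1 else x (i (Suc n))) / (if p then 1 else x (i 1)) *
    band_matrix H i a bT x y (Suc n) $ state_index q $ state_index p" for q
    using Suc.prems by (intro Suc.IH) auto
  define M where "M = band_matrix H i a bT x y (Suc n)"
  define X where "X = (\<Prod>k\<in>{1..n}. x (i k))"
  have X: "(\<Prod>k\<in>{1..Suc n}. x (i k)) = X * x (i (Suc n))" by (simp add: X_def)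
  \<comment> \<open>With \<open>k = Suc n\<close>, all cases come from one identity: entry
    \<open>(q, r)\<close> of the step matrix times \<open>x (i k)\<close>, and times
    \<open>x (i (k + 1))\<close> if \<open>q\<close> is \<open>False\<close>, equals the weight of
    the transition from \<open>r\<close> to \<open>q\<close>, times \<open>x (i k)\<close> if
    \<open>r\<close> is \<open>False\<close>. Rows belong to the later state because new factors are
    multiplied on the left.\<close>
  show ?case
    unfolding chain_sum.simps IH band_matrix.simps M_def[symmetric] X X_def[symmetric]
    using nz
    by (cases p; cases q; cases "first_type H (Suc n)"; cases "bT (i (Suc n)) = 1")
      (simp_all add: UNIV_bool state_index_def matrix_matrix_mult_def sum_2 step_matrix_def
        trans_weight_def tile_weight_def field_simps)
qed

section \<open>Closing the chain into a trace\<close>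

theorem theorem6p4:
  fixes d :: nat
    and H :: "nat \<Rightarrow> shape"
    and i a :: "nat \<Rightarrow> 'l"
    and c :: 'l
    and bT :: "'l \<Rightarrow> int"
    and x y :: "'l \<Rightarrow> 'k::field"
  assumes "d \<ge> 1"
    and "\<forall>j\<in>{1..d}. bT (i j) \<in> {1, -1}"
    and "\<forall>j\<in>{1..d}. x (i j) \<noteq> 0"
  shows "(bT (i d) = 1 \<longrightarrow>
            (\<Sum>P | good_matching d H P. x_weight d H i a c x P * y_weight d H i bT y P) =
            (\<Prod>j=1..d. x (i j)) *
              trace (mat22 (x c / x (i d)) (x (i 1) * y (i d))
                           (1 / x (i 1))   0
                     ** band_matrix H i a bT x y d))
       \<and> (bT (i d) = -1 \<longrightarrow>
            (\<Sum>P | good_matching d H P. x_weight d H i a c x P * y_weight d H i bT y P) =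
            (\<Prod>j=1..d. x (i j)) *
              trace (mat22 (x c * y (i d) / x (i d)) (x (i 1))
                           (y (i d) / x (i 1))       0
                     ** band_matrix H i a bT x y d))"
proof -
  obtain n where d: "d = Suc n" using assms(1) by (cases d) auto
  let ?g = "\<lambda>k p q. trans_weight H i a x k p q * tile_weight i bT y k p"
  \<comment> \<open>\<open>?g\<close> charges the \<open>y\<close>-factor of a tile to the
    transition leaving it; tile \<open>d\<close> has none, so its factor goes into the closing
    weight.\<close>
  let ?h = "\<lambda>p q. end_weight d i c x p q * tile_weight i bT y d q"
  let ?W = "\<lambda>T. (\<Prod>k\<in>{1..n}. ?g k (k \<in> T) (Suc k \<in> T)) * ?h (1 \<in> T) (d \<in> T)"
  let ?G = "{T. T \<subseteq> {1..d} \<and> admissible d H (orient T) \<and> (1 \<in> T \<or> d \<in> T)}"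
  have ivl: "{1..<d} = {1..n}" "{1..d} = insert d {1..n}" "d \<notin> {1..n}" by (auto simp: d)
  have "(\<Sum>P | good_matching d H P. x_weight d H i a c x P * y_weight d H i bT y P) = sum ?W ?G"
    unfolding good_matching_sum[OF assms(1)]
  proof (rule sum.cong[OF refl])
    fix T assume T: "T \<in> ?G"
    have "x_weight d H i a c x (matching_of d H (orient T)) =
        (\<Prod>k\<in>{1..n}. trans_weight H i a x k (k \<in> T) (Suc k \<in> T)) *
        end_weight d i c x (1 \<in> T) (d \<in> T)"
      using T x_weight_matching_of[OF assms(1), of H T i a c x] unfolding ivl(1) by blast
    moreover have "y_weight d H i bT y (matching_of d H (orient T)) =
        tile_weight i bT y d (d \<in> T) * (\<Prod>k\<in>{1..n}. tile_weight i bT y k (k \<in> T))"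
      using y_weight_matching_of[where i = i and bT = bT, OF assms(1,2), of H y T] ivl(2,3)
      by simp
    ultimately show "x_weight d H i a c x (matching_of d H (orient T)) *
        y_weight d H i bT y (matching_of d H (orient T)) = ?W T"
      by (simp add: prod.distrib)
  qed
  \<comment> \<open>An inadmissible state set contains a transition of weight \<open>0\<close>, and
    one with neither end state \<open>True\<close> has end weight \<open>0\<close>.\<close>
  also have "\<dots> = sum ?W {T. T \<subseteq> {1..d}}"
  proof (rule sum.mono_neutral_left)
    show "\<forall>T\<in>{T. T \<subseteq> {1..d}} - ?G. ?W T = 0"
    proof
      fix T assume T: "T \<in> {T. T \<subseteq> {1..d}} - ?G"
      show "?W T = 0"
      proof (cases "admissible d H (orient T)")
        case True
        then show ?thesis using T by (auto simp: end_weight_def)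
      next
        case False
        then obtain k where "k \<in> {1..n}" "trans_weight H i a x k (k \<in> T) (Suc k \<in> T) = 0"
          using trans_weight_zero ivl(1) by metis
        then have "(\<Prod>k\<in>{1..n}. ?g k (k \<in> T) (Suc k \<in> T)) = 0"
          by (intro prod_zero) auto
        then show ?thesis by simp
      qed
    qed
  qed auto
  also have "\<dots> = (\<Sum>(p, q)\<in>UNIV. chain_sum ?g p n q * ?h p q)"
    unfolding d by (rule sum_end_states)
  \<comment> \<open>The pair \<open>(False, False)\<close> has end weight \<open>0\<close>, which is
    the entry \<open>0\<close> of the closing matrix; the other three terms belong to its other
    entries.\<close>
  also have "\<dots> = chain_sum ?g True n True * ?h True True +
      chain_sum ?g True n False * ?h True False + chain_sum ?g False n True * ?h False True"
    unfolding UNIV_Times_UNIV[symmetric] sum.cartesian_product[symmetric]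
    by (simp add: UNIV_bool end_weight_def add_ac)
  finally have main: "(\<Sum>P | good_matching d H P. x_weight d H i a c x P * y_weight d H i bT y P) =
      chain_sum ?g True n True * ?h True True +
      chain_sum ?g True n False * ?h True False + chain_sum ?g False n True * ?h False True" .
  have nz: "\<forall>j\<in>{1..Suc n}. x (i j) \<noteq> 0" using assms(3) by (simp add: d)
  have nz1: "x (i 1) \<noteq> 0" "x (i d) \<noteq> 0" using assms(1,3) by auto
  have X: "(\<Prod>j=1..d. x (i j)) = x (i d) * (\<Prod>j\<in>{1..n}. x (i j))"
    using ivl(2,3) by simp
  \<comment> \<open>The closing matrix absorbs the factors \<open>x (i 1)\<close> and
    \<open>x (i d)\<close> left by the change of basis at both ends. Its entry \<open>(1, 2)\<close>
    meets entry \<open>(2, 1)\<close> of the band matrix, the chain from \<open>True\<close> to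
    \<open>False\<close>.\<close>
  show ?thesis
    unfolding main chain_sum_band_matrix[where x = x and i = i, OF nz] X
    unfolding d[symmetric] trace_def matrix_matrix_mult_def
    using nz1
    by (simp add: sum_2 state_index_def end_weight_def tile_weight_def field_simps)
qed

end
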